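(* Let $B$ be an $S$-graded $\mathbb{F}$-algebra, $C$ a $T$-graded $\mathbb{F}$-algebra, and $\alpha\in P(S,T,\mathbb{F}^\times)$ a pairing. There exists a unique $S\times T$-graded algebra product $*$ on the underlying vector space $B\otimes C$ such that $B\cong B\otimes\{1_C\}$ and $C\cong\{1_B\}\otimes C$ are subalgebras, and $c*b=\alpha(s,t)\,b\otimes c$ for all $b\in B_s$ and $c\in C_t$ with $s\in S$, $t\in T$.
   Context: $\mathbb{F}$ is a field, and $S$ and $T$ are monoids. For a monoid $S$ with identity $e$, an $S$-graded $\mathbb{F}$-algebra is a unital associative algebra $A=\bigoplus_{s\in S}A_s$ with $A_sA_t\subseteq A_{st}$ for all $s,t\in S$ and $1_A\in A_e$. $P(S,T,\mathbb{F}^\times)$ is the set of bimultiplicative pairings, i.e. maps $\alpha\colon S\times T\to\mathbb{F}^\times$ with $\alpha(ss',t)=\alpha(s,t)\alpha(s',t)$ and $\alpha(s,tt')=\alpha(s,t)\alpha(s,t')$ for all $s,s'\in S$, $t,t'\in T$. Tensor products are over $\mathbb{F}$, and $B\otimes C$ is $S\times T$-graded by $(B\otimes C)_{(s,t)}=B_s\otimes C_t$. Elements $b\in B$ are identified with $b\otimes 1_C$ and elements $c\in C$ with $1_B\otimes c$, so $c*b$ means $(1_B\otimes c)*(b\otimes 1_C)$.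
   Formalization: The product is also required to satisfy b*c = b⊗c, without which uniqueness fails (e.g. the quaternions on ℂ⊗ℂ over ℝ); and B ≅ B⊗{1_C} (resp. C ≅ {1_B}⊗C) is claimed injectively only when C (resp. B) is nonzero. *)

theory Defs
  imports
    "HOL-Algebra.Module"
    "HOL-Algebra.Subrings"
    "HOL-Algebra.Free_Abelian_Groups"
begin

section \<open>Graded algebras and pairings\<close>

text \<open>The library locale \<open>algebra\<close> is restricted to commutative algebras.  The zero algebra is
  admitted.\<close>

locale unital_algebra = F?: field F + module F A + A?: ring A for F (structure) and A (structure) +
  assumes smult_mult_left:
      "\<lbrakk>r \<in> carrier F; x \<in> carrier A; y \<in> carrier A\<rbrakk> \<Longrightarrow>
        (r \<odot>\<^bsub>A\<^esub> x) \<otimes>\<^bsub>A\<^esub> y = r \<odot>\<^bsub>A\<^esub> (x \<otimes>\<^bsub>A\<^esub> y)"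
    and smult_mult_right:
      "\<lbrakk>r \<in> carrier F; x \<in> carrier A; y \<in> carrier A\<rbrakk> \<Longrightarrow>
        x \<otimes>\<^bsub>A\<^esub> (r \<odot>\<^bsub>A\<^esub> y) = r \<odot>\<^bsub>A\<^esub> (x \<otimes>\<^bsub>A\<^esub> y)"

text \<open>The grading is the family \<open>D\<close> of homogeneous components; only its values on
  \<open>carrier S\<close> matter.  The assumption \<open>decomposition\<close> says that \<open>A\<close> is the direct sum of this
  family.\<close>

locale graded_algebra = S: monoid S + unital_algebra F A
  for F :: "('f, 'n) ring_scheme" (structure)
    and S :: "('s, 'k) monoid_scheme" (structure)
    and A :: "('f, 'a, 'p) module_scheme" (structure) +
  fixes D :: "'s \<Rightarrow> 'a set"
  assumes component_submodule: "s \<in> carrier S \<Longrightarrow> submodule (D s) F A"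
    and decomposition: "x \<in> carrier A \<Longrightarrow>
        \<exists>!f. f \<in> (\<Pi>\<^sub>E s\<in>carrier S. D s) \<and> finite {s \<in> carrier S. f s \<noteq> \<zero>\<^bsub>A\<^esub>} \<and>
             x = finsum A f {s \<in> carrier S. f s \<noteq> \<zero>\<^bsub>A\<^esub>}"
    and component_mult: "\<lbrakk>s \<in> carrier S; t \<in> carrier S; x \<in> D s; y \<in> D t\<rbrakk> \<Longrightarrow>
        x \<otimes>\<^bsub>A\<^esub> y \<in> D (s \<otimes>\<^bsub>S\<^esub> t)"
    and one_component: "\<one>\<^bsub>A\<^esub> \<in> D \<one>\<^bsub>S\<^esub>"

definition pairings ::
  "('s, 'k) monoid_scheme \<Rightarrow> ('t, 'l) monoid_scheme \<Rightarrow> ('f, 'n) ring_scheme \<Rightarrow> ('s \<Rightarrow> 't \<Rightarrow> 'f) set"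
  where "pairings S T F = {\<alpha>.
    (\<forall>s\<in>carrier S. \<forall>t\<in>carrier T. \<alpha> s t \<in> Units F) \<and>
    (\<forall>s\<in>carrier S. \<forall>s'\<in>carrier S. \<forall>t\<in>carrier T.
       \<alpha> (s \<otimes>\<^bsub>S\<^esub> s') t = \<alpha> s t \<otimes>\<^bsub>F\<^esub> \<alpha> s' t) \<and>
    (\<forall>s\<in>carrier S. \<forall>t\<in>carrier T. \<forall>t'\<in>carrier T.
       \<alpha> s (t \<otimes>\<^bsub>T\<^esub> t') = \<alpha> s t \<otimes>\<^bsub>F\<^esub> \<alpha> s t')}"

definition algebra_hom ::
  "('f, 'n) ring_scheme \<Rightarrow> ('f, 'a, 'p) module_scheme \<Rightarrow> ('f, 'b, 'q) module_scheme \<Rightarrow> ('a \<Rightarrow> 'b) set"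
  where "algebra_hom F A A' =
    {h \<in> ring_hom A A'. \<forall>r\<in>carrier F. \<forall>x\<in>carrier A. h (r \<odot>\<^bsub>A\<^esub> x) = r \<odot>\<^bsub>A'\<^esub> h x}"

definition unital_subalgebra ::
  "'a set \<Rightarrow> ('f, 'n) ring_scheme \<Rightarrow> ('f, 'a, 'p) module_scheme \<Rightarrow> bool"
  where "unital_subalgebra H F A \<longleftrightarrow> submodule H F A \<and> subring H A"


section \<open>Tensor products\<close>

text \<open>The tensor product over \<open>F\<close> is the free abelian group on the set \<open>B \<times> C\<close> modulo biadditivity
  and \<open>F\<close>-balancedness; its elements are cosets.  The quotient inherits the scalar multiplication
  that sends a generator \<open>(b, c)\<close> to \<open>(r b, c)\<close>.\<close>

definition tensor_relations ::
  "('f, 'n) ring_scheme \<Rightarrow> ('f, 'b, 'p) module_scheme \<Rightarrow> ('f, 'c, 'q) module_scheme \<Rightarrow>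
    (('b \<times> 'c) \<Rightarrow>\<^sub>0 int) set"
  where "tensor_relations F B C =
    {frag_of (b \<oplus>\<^bsub>B\<^esub> b', c) - frag_of (b, c) - frag_of (b', c) | b b' c.
       b \<in> carrier B \<and> b' \<in> carrier B \<and> c \<in> carrier C} \<union>
    {frag_of (b, c \<oplus>\<^bsub>C\<^esub> c') - frag_of (b, c) - frag_of (b, c') | b c c'.
       b \<in> carrier B \<and> c \<in> carrier C \<and> c' \<in> carrier C} \<union>
    {frag_of (r \<odot>\<^bsub>B\<^esub> b, c) - frag_of (b, r \<odot>\<^bsub>C\<^esub> c) | r b c.
       r \<in> carrier F \<and> b \<in> carrier B \<and> c \<in> carrier C}"

abbreviation tensor_free ::
  "('f, 'b, 'p) module_scheme \<Rightarrow> ('f, 'c, 'q) module_scheme \<Rightarrow> (('b \<times> 'c) \<Rightarrow>\<^sub>0 int) monoid"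
  where "tensor_free B C \<equiv> free_Abelian_group (carrier B \<times> carrier C)"

definition tensor_kernel ::
  "('f, 'n) ring_scheme \<Rightarrow> ('f, 'b, 'p) module_scheme \<Rightarrow> ('f, 'c, 'q) module_scheme \<Rightarrow>
    (('b \<times> 'c) \<Rightarrow>\<^sub>0 int) set"
  where "tensor_kernel F B C = generate (tensor_free B C) (tensor_relations F B C)"

definition pure_tensor ::
  "('f, 'n) ring_scheme \<Rightarrow> ('f, 'b, 'p) module_scheme \<Rightarrow> ('f, 'c, 'q) module_scheme \<Rightarrow>
    'b \<Rightarrow> 'c \<Rightarrow> (('b \<times> 'c) \<Rightarrow>\<^sub>0 int) set"
  where "pure_tensor F B C b c = tensor_kernel F B C #>\<^bsub>tensor_free B C\<^esub> frag_of (b, c)"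

text \<open>The vector space \<open>B \<otimes> C\<close> equipped with a multiplication \<open>m\<close> and a unit \<open>u\<close>.\<close>

definition tensor_algebra ::
  "('f, 'n) ring_scheme \<Rightarrow> ('f, 'b, 'p) module_scheme \<Rightarrow> ('f, 'c, 'q) module_scheme \<Rightarrow>
    ((('b \<times> 'c) \<Rightarrow>\<^sub>0 int) set \<Rightarrow> (('b \<times> 'c) \<Rightarrow>\<^sub>0 int) set \<Rightarrow> (('b \<times> 'c) \<Rightarrow>\<^sub>0 int) set) \<Rightarrow>
    (('b \<times> 'c) \<Rightarrow>\<^sub>0 int) set \<Rightarrow>
    ('f, (('b \<times> 'c) \<Rightarrow>\<^sub>0 int) set) module"
  where "tensor_algebra F B C m u =
    \<lparr>carrier = carrier (tensor_free B C Mod tensor_kernel F B C),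
     monoid.mult = m,
     monoid.one = u,
     ring.zero = \<one>\<^bsub>tensor_free B C Mod tensor_kernel F B C\<^esub>,
     ring.add = (\<otimes>\<^bsub>tensor_free B C Mod tensor_kernel F B C\<^esub>),
     module.smult = (\<lambda>r X. tensor_kernel F B C <#>\<^bsub>tensor_free B C\<^esub>
                frag_extend (\<lambda>(b, c). frag_of (r \<odot>\<^bsub>B\<^esub> b, c)) ` X)\<rparr>"

text \<open>This carrier does not depend on a choice of multiplication and unit.\<close>

definition tensor_carrier ::
  "('f, 'n) ring_scheme \<Rightarrow> ('f, 'b, 'p) module_scheme \<Rightarrow> ('f, 'c, 'q) module_scheme \<Rightarrow>
    (('b \<times> 'c) \<Rightarrow>\<^sub>0 int) set set"
  where "tensor_carrier F B C = carrier (tensor_free B C Mod tensor_kernel F B C)"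

text \<open>The component \<open>B\<^sub>s \<otimes> C\<^sub>t\<close>, as a subspace of \<open>B \<otimes> C\<close>: the finite sums of pure tensors with
  factors in \<open>B\<^sub>s\<close> and \<open>C\<^sub>t\<close>.  Scalars are absorbed into the left factor, so the additive subgroup
  generated by these pure tensors is already a subspace.\<close>

definition tensor_grading ::
  "('f, 'n) ring_scheme \<Rightarrow> ('f, 'b, 'p) module_scheme \<Rightarrow> ('s \<Rightarrow> 'b set) \<Rightarrow>
    ('f, 'c, 'q) module_scheme \<Rightarrow> ('t \<Rightarrow> 'c set) \<Rightarrow> 's \<times> 't \<Rightarrow> (('b \<times> 'c) \<Rightarrow>\<^sub>0 int) set set"
  where "tensor_grading F B DB C DC = (\<lambda>(s, t).
    generate (tensor_free B C Mod tensor_kernel F B C)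
      {pure_tensor F B C b c | b c. b \<in> DB s \<and> c \<in> DC t})"


section \<open>Twisted products\<close>

text \<open>The conditions on the product \<open>m\<close> with unit \<open>u\<close>.  Identifying \<open>b\<close> with \<open>b \<otimes> 1\<close> and \<open>c\<close> with
  \<open>1 \<otimes> c\<close> includes reading the tensor \<open>b \<otimes> c\<close> as the product of \<open>b\<close> and \<open>c\<close>, which is the condition
  \<open>m (b \<otimes> 1) (1 \<otimes> c) = b \<otimes> c\<close>.  Without it there is no uniqueness: for trivial monoids and
  \<open>B = C = \<complex>\<close> over \<open>\<real>\<close>, the linear bijection from \<open>B \<otimes> C\<close> to the quaternions that sends \<open>b \<otimes> c\<close> to
  \<open>c b\<close>, with \<open>B = \<real> + \<real>i\<close> and \<open>C = \<real> + \<real>j\<close>, transports a product that satisfies all the other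
  conditions and differs from the ordinary product of \<open>\<complex> \<otimes> \<complex>\<close>.

  The map from \<open>B\<close> to \<open>B \<otimes> {1}\<close> cannot be injective if \<open>C\<close> is the zero algebra and \<open>B\<close> is not, which
  is why injectivity is required for nonzero \<open>C\<close> only, and likewise for \<open>C\<close>.\<close>

definition twisted_product where
  "twisted_product F S B DB T C DC \<alpha> m u \<longleftrightarrow>
     (let A = tensor_algebra F B C m u;
          \<iota>\<^sub>B = (\<lambda>b. pure_tensor F B C b \<one>\<^bsub>C\<^esub>);
          \<iota>\<^sub>C = (\<lambda>c. pure_tensor F B C \<one>\<^bsub>B\<^esub> c)
      in graded_algebra F (S \<times>\<times> T) A (tensor_grading F B DB C DC) \<and>
         \<iota>\<^sub>B \<in> algebra_hom F B A \<and> unital_subalgebra (\<iota>\<^sub>B ` carrier B) F A \<and>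
         (\<one>\<^bsub>C\<^esub> \<noteq> \<zero>\<^bsub>C\<^esub> \<longrightarrow> inj_on \<iota>\<^sub>B (carrier B)) \<and>
         \<iota>\<^sub>C \<in> algebra_hom F C A \<and> unital_subalgebra (\<iota>\<^sub>C ` carrier C) F A \<and>
         (\<one>\<^bsub>B\<^esub> \<noteq> \<zero>\<^bsub>B\<^esub> \<longrightarrow> inj_on \<iota>\<^sub>C (carrier C)) \<and>
         (\<forall>b\<in>carrier B. \<forall>c\<in>carrier C. \<iota>\<^sub>B b \<otimes>\<^bsub>A\<^esub> \<iota>\<^sub>C c = pure_tensor F B C b c) \<and>
         (\<forall>s\<in>carrier S. \<forall>t\<in>carrier T. \<forall>b\<in>DB s. \<forall>c\<in>DC t.
            \<iota>\<^sub>C c \<otimes>\<^bsub>A\<^esub> \<iota>\<^sub>B b = \<alpha> s t \<odot>\<^bsub>A\<^esub> pure_tensor F B C b c))"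

end

theory Submission
  imports Defs
begin

text \<open>
  Reading \<open>b \<otimes> c\<close> as the product of \<open>b\<close> and \<open>c\<close>, associativity forces
  \<open>(b \<otimes> c) (b' \<otimes> c') = b (c b') c' = \<alpha>(s, t) bb' \<otimes> cc'\<close> for \<open>b' \<in> B\<^sub>s\<close> and \<open>c \<in> C\<^sub>t\<close>, and homogeneous pure
  tensors span, so the product is unique.  Conversely this formula defines a bilinear product by
  the universal properties of the tensor product and of the direct sum decompositions, and
  associativity on homogeneous pure tensors is the bimultiplicativity of \<open>\<alpha>\<close>.  The grading is
  direct because the pairs of component projections act on \<open>B \<otimes> C\<close>, and \<open>b \<mapsto> b \<otimes> 1\<close> is injective
  because \<open>C\<close> has a linear functional with value \<open>1\<close> at \<open>1 \<noteq> 0\<close>.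
\<close>

section \<open>Tensor products of modules\<close>

text \<open>Uniqueness and existence meet in the locale \<open>twisted_tensor\<close>: every twisted
  product is an instance of it, two instances agree on B \<otimes> C, and every instance is a
  twisted product with unit 1 \<otimes> 1. What remains is to construct one instance. The obstacle
  is that the scalar \<alpha>(s, t) depends on the degrees of b' and c jointly, while the universal
  property of the tensor product only accepts maps defined for all b and c. Hence one degree is
  fixed while the other variable is extended: each s gives an additive map of C, and the direct sum
  decomposition of B then merges the resulting maps. The tensor product is a quotient of a free
  abelian group, so its universal property yields additive maps only; compatibility with scalars is
  proved separately, by induction on generators.\<close>

lemma keys_add_subset:
  "Poly_Mapping.keys x \<subseteq> A \<Longrightarrow> Poly_Mapping.keys y \<subseteq> A \<Longrightarrow> Poly_Mapping.keys (x + y) \<subseteq> A"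
  using keys_add[of x y] by blast

lemma keys_diff_subset:
  fixes x y :: "'a \<Rightarrow>\<^sub>0 int"
  shows "Poly_Mapping.keys x \<subseteq> A \<Longrightarrow> Poly_Mapping.keys y \<subseteq> A \<Longrightarrow> Poly_Mapping.keys (x - y) \<subseteq> A"
  using keys_diff[of x y] by blast

lemma (in abelian_group) a_inv_zero: "\<ominus> \<zero> = \<zero>"
  using add.inv_one by (simp add: a_inv_def)

section \<open>Cosets modulo the tensor relations\<close>

locale tensor_product = B: module F B + C: module F C
  for F :: "('f, 'n) ring_scheme"
    and B :: "('f, 'b, 'p) module_scheme"
    and C :: "('f, 'c, 'q) module_scheme"
begin

abbreviation K where "K \<equiv> tensor_kernel F B C"

abbreviation pure (infixl \<open>\<boxtimes>\<close> 75) where "b \<boxtimes> c \<equiv> pure_tensor F B C b c"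

text \<open>The bare vector space: carrier, addition and scalars of \<open>tensor_algebra\<close>
  are the same for every product and unit, so \<open>undefined\<close> in both places picks one
  record, and \<open>tensor_algebra_simps\<close> rewrites all others to it.\<close>

definition V :: "('f, (('b \<times> 'c) \<Rightarrow>\<^sub>0 int) set) module"
  where "V = tensor_algebra F B C undefined undefined"

lemma tensor_algebra_simps:
  "carrier (tensor_algebra F B C m u) = carrier V"
  "\<zero>\<^bsub>tensor_algebra F B C m u\<^esub> = \<zero>\<^bsub>V\<^esub>"
  "x \<oplus>\<^bsub>tensor_algebra F B C m u\<^esub> y = x \<oplus>\<^bsub>V\<^esub> y"
  "r \<odot>\<^bsub>tensor_algebra F B C m u\<^esub> x = r \<odot>\<^bsub>V\<^esub> x"
  "x \<otimes>\<^bsub>tensor_algebra F B C m u\<^esub> y = m x y"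
  "\<one>\<^bsub>tensor_algebra F B C m u\<^esub> = u"
  by (simp_all add: V_def tensor_algebra_def)

lemma tensor_carrier_eq: "tensor_carrier F B C = carrier V"
  by (simp add: V_def tensor_algebra_def tensor_carrier_def)

lemma relations_cases [consumes 1, case_names left right balanced]:
  assumes "x \<in> tensor_relations F B C"
  obtains b b' c where "b \<in> carrier B" "b' \<in> carrier B" "c \<in> carrier C"
      "x = frag_of (b \<oplus>\<^bsub>B\<^esub> b', c) - frag_of (b, c) - frag_of (b', c)"
    | b c c' where "b \<in> carrier B" "c \<in> carrier C" "c' \<in> carrier C"
      "x = frag_of (b, c \<oplus>\<^bsub>C\<^esub> c') - frag_of (b, c) - frag_of (b, c')"
    | r b c where "r \<in> carrier F" "b \<in> carrier B" "c \<in> carrier C"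
      "x = frag_of (r \<odot>\<^bsub>B\<^esub> b, c) - frag_of (b, r \<odot>\<^bsub>C\<^esub> c)"
  using assms unfolding tensor_relations_def
  by (elim UnE CollectE exE conjE) (rule that; assumption)+

lemma relationsI:
  "b \<in> carrier B \<Longrightarrow> b' \<in> carrier B \<Longrightarrow> c \<in> carrier C \<Longrightarrow>
    frag_of (b \<oplus>\<^bsub>B\<^esub> b', c) - frag_of (b, c) - frag_of (b', c) \<in> tensor_relations F B C"
  "b \<in> carrier B \<Longrightarrow> c \<in> carrier C \<Longrightarrow> c' \<in> carrier C \<Longrightarrow>
    frag_of (b, c \<oplus>\<^bsub>C\<^esub> c') - frag_of (b, c) - frag_of (b, c') \<in> tensor_relations F B C"
  "r \<in> carrier F \<Longrightarrow> b \<in> carrier B \<Longrightarrow> c \<in> carrier C \<Longrightarrow>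
    frag_of (r \<odot>\<^bsub>B\<^esub> b, c) - frag_of (b, r \<odot>\<^bsub>C\<^esub> c) \<in> tensor_relations F B C"
  unfolding tensor_relations_def by blast+

lemma relations_closed: "tensor_relations F B C \<subseteq> carrier (tensor_free B C)"
proof
  fix x assume "x \<in> tensor_relations F B C"
  then show "x \<in> carrier (tensor_free B C)"
    by (cases rule: relations_cases) (simp_all add: keys_diff_subset)
qed

lemma free_comm_group: "comm_group (tensor_free B C)"
  by (rule abelian_free_Abelian_group)

lemma kernel_subgroup: "subgroup K (tensor_free B C)"
  unfolding tensor_kernel_def
  by (intro group.generate_is_subgroup relations_closed group_free_Abelian_group)

lemma kernel_normal: "K \<lhd> tensor_free B C"
  by (rule comm_group.subgroup_imp_normal[OF free_comm_group kernel_subgroup])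

lemma kernel_add: "k \<in> K \<Longrightarrow> l \<in> K \<Longrightarrow> k + l \<in> K"
  and kernel_zero: "0 \<in> K"
  using subgroup.m_closed[OF kernel_subgroup, of k l] subgroup.one_closed[OF kernel_subgroup]
  by simp_all

lemma kernel_keys: "k \<in> K \<Longrightarrow> Poly_Mapping.keys k \<subseteq> carrier B \<times> carrier C"
  using subgroup.mem_carrier[OF kernel_subgroup, of k] by simp

lemma kernel_minus: "k \<in> K \<Longrightarrow> - k \<in> K"
  using subgroup.m_inv_closed[OF kernel_subgroup, of k] kernel_keys[of k] by simp

abbreviation coset where "coset x \<equiv> K #>\<^bsub>tensor_free B C\<^esub> x"

lemma coset_eq: "coset x = {k + x | k. k \<in> K}"
  by (auto simp: r_coset_def)

lemma coset_eqI:
  assumes "x - y \<in> K"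
  shows "coset x = coset y"
proof -
  have "k + x \<in> coset y" if "k \<in> K" for k
  proof -
    have "k + x = (k + (x - y)) + y"
      by simp
    then show ?thesis
      using kernel_add[OF that assms] by (auto simp only: coset_eq)
  qed
  moreover have "k + y \<in> coset x" if "k \<in> K" for k
  proof -
    have "k + y = (k + - (x - y)) + x"
      by simp
    then show ?thesis
      using kernel_add[OF that kernel_minus[OF assms]] by (auto simp only: coset_eq)
  qed
  ultimately show ?thesis
    by (auto simp only: coset_eq[of x] coset_eq[of y])
qed

lemma coset_eqD: "coset x = coset y \<Longrightarrow> x - y \<in> K"
proof -
  assume eq: "coset x = coset y"
  have "\<exists>k. x = k + x \<and> k \<in> K"
    by (rule exI[of _ 0]) (simp add: kernel_zero)
  then have "x \<in> coset y"
    unfolding eq[symmetric] unfolding coset_eq by (rule CollectI)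
  then obtain k where k: "x = k + y" "k \<in> K"
    unfolding coset_eq by (elim CollectE exE conjE)
  have "x - y = k"
    unfolding k(1) by (rule add_diff_cancel_right')
  with k(2) show ?thesis
    by simp
qed

lemma carrier_V: "carrier V = coset ` {x. Poly_Mapping.keys x \<subseteq> carrier B \<times> carrier C}"
  proof -
  have "carrier (tensor_free B C) = {x. Poly_Mapping.keys x \<subseteq> carrier B \<times> carrier C}"
    by auto
  then show ?thesis
    by (simp add: V_def tensor_algebra_def carrier_FactGroup)
qed

lemma add_coset:
  assumes "Poly_Mapping.keys x \<subseteq> carrier B \<times> carrier C" "Poly_Mapping.keys y \<subseteq> carrier B \<times> carrier C"
  shows "coset x \<oplus>\<^bsub>V\<^esub> coset y = coset (x + y)"
  using normal.rcos_sum[OF kernel_normal, of x y] assms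
  by (simp add: V_def tensor_algebra_def)

lemma zero_V: "\<zero>\<^bsub>V\<^esub> = coset 0"
  by (simp add: V_def tensor_algebra_def coset_eq)

lemma abelian_group_V: "abelian_group V"
proof -
  let ?Q = "tensor_free B C Mod K"
  interpret Q: comm_group ?Q
    by (rule comm_group.abelian_FactGroup[OF free_comm_group kernel_subgroup])
  have V: "carrier V = carrier ?Q" "add V = monoid.mult ?Q" "ring.zero V = one ?Q"
    by (simp_all add: V_def tensor_algebra_def)
  show ?thesis
  proof (rule abelian_groupI)
    fix x assume "x \<in> carrier V"
    then show "\<exists>y\<in>carrier V. y \<oplus>\<^bsub>V\<^esub> x = \<zero>\<^bsub>V\<^esub>"
      unfolding V using Q.inv_closed Q.l_inv by blast
  qed (unfold V; (rule Q.m_closed Q.one_closed Q.m_assoc Q.m_comm Q.l_one; assumption))+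
qed

sublocale V: abelian_group V
  by (rule abelian_group_V)

text \<open>Needed because \<open>tensor_grading\<close> generates its subgroups in the quotient
  group, so negatives of elements of a component first appear as inverses there.\<close>

lemma a_inv_V: "a_inv V x = inv\<^bsub>tensor_free B C Mod K\<^esub> x"
  by (simp add: V_def tensor_algebra_def a_inv_def m_inv_def)

section \<open>Pure tensors: bilinearity, spanning and the universal property\<close>

lemma pure_closed [simp, intro]: "b \<in> carrier B \<Longrightarrow> c \<in> carrier C \<Longrightarrow> b \<boxtimes> c \<in> carrier V"
  by (auto simp: pure_tensor_def carrier_V)

lemma relation_coset: "x - y \<in> tensor_relations F B C \<Longrightarrow> coset x = coset y"
  by (rule coset_eqI) (auto simp: tensor_kernel_def intro: generate.incl)

lemma pure_add_left:
  assumes "b \<in> carrier B" "b' \<in> carrier B" "c \<in> carrier C"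
  shows "(b \<oplus>\<^bsub>B\<^esub> b') \<boxtimes> c = b \<boxtimes> c \<oplus>\<^bsub>V\<^esub> b' \<boxtimes> c"
proof -
  have "frag_of (b \<oplus>\<^bsub>B\<^esub> b', c) - (frag_of (b, c) + frag_of (b', c)) \<in> tensor_relations F B C"
    using assms by (simp add: diff_diff_eq[symmetric] relationsI)
  then show ?thesis
    using assms by (simp add: pure_tensor_def add_coset relation_coset)
qed

lemma pure_add_right:
  assumes "b \<in> carrier B" "c \<in> carrier C" "c' \<in> carrier C"
  shows "b \<boxtimes> (c \<oplus>\<^bsub>C\<^esub> c') = b \<boxtimes> c \<oplus>\<^bsub>V\<^esub> b \<boxtimes> c'"
proof -
  have "frag_of (b, c \<oplus>\<^bsub>C\<^esub> c') - (frag_of (b, c) + frag_of (b, c')) \<in> tensor_relations F B C"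
    using assms by (simp add: diff_diff_eq[symmetric] relationsI)
  then show ?thesis
    using assms by (simp add: pure_tensor_def add_coset relation_coset)
qed

lemma pure_balanced:
  assumes "r \<in> carrier F" "b \<in> carrier B" "c \<in> carrier C"
  shows "(r \<odot>\<^bsub>B\<^esub> b) \<boxtimes> c = b \<boxtimes> (r \<odot>\<^bsub>C\<^esub> c)"
proof -
  have "frag_of (r \<odot>\<^bsub>B\<^esub> b, c) - frag_of (b, r \<odot>\<^bsub>C\<^esub> c) \<in> tensor_relations F B C"
    using assms by (rule relationsI)
  then show ?thesis
    by (simp add: pure_tensor_def relation_coset)
qed

lemma pure_zero_left [simp]: "c \<in> carrier C \<Longrightarrow> \<zero>\<^bsub>B\<^esub> \<boxtimes> c = \<zero>\<^bsub>V\<^esub>"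
  using pure_add_left[of "\<zero>\<^bsub>B\<^esub>" "\<zero>\<^bsub>B\<^esub>" c] by (simp add: V.add.l_cancel_one')

lemma pure_zero_right [simp]: "b \<in> carrier B \<Longrightarrow> b \<boxtimes> \<zero>\<^bsub>C\<^esub> = \<zero>\<^bsub>V\<^esub>"
  using pure_add_right[of b "\<zero>\<^bsub>C\<^esub>" "\<zero>\<^bsub>C\<^esub>"] by (simp add: V.add.l_cancel_one')

lemma pure_minus_left:
  "b \<in> carrier B \<Longrightarrow> c \<in> carrier C \<Longrightarrow> (\<ominus>\<^bsub>B\<^esub> b) \<boxtimes> c = \<ominus>\<^bsub>V\<^esub> (b \<boxtimes> c)"
  using pure_add_left[of "\<ominus>\<^bsub>B\<^esub> b" b c]
  by (metis B.M.a_inv_closed B.M.l_neg V.minus_equality pure_closed pure_zero_left)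

text \<open>No case for zero or for negatives is required: 0 = 0 \<otimes> 0 and -(b \<otimes> c) =
  (-b) \<otimes> c are again pure, so the sums of pure tensors already form the whole group.\<close>

lemma tensor_induct [consumes 1, case_names pure add]:
  assumes "x \<in> carrier V"
    and pure: "\<And>b c. b \<in> carrier B \<Longrightarrow> c \<in> carrier C \<Longrightarrow> P (b \<boxtimes> c)"
    and add: "\<And>x y. x \<in> carrier V \<Longrightarrow> y \<in> carrier V \<Longrightarrow> P x \<Longrightarrow> P y \<Longrightarrow> P (x \<oplus>\<^bsub>V\<^esub> y)"
  shows "P x"
proof -
  obtain z where z: "Poly_Mapping.keys z \<subseteq> carrier B \<times> carrier C" "x = coset z"
    using assms(1) by (auto simp: carrier_V)
  have cs: "coset u \<in> carrier V" if "Poly_Mapping.keys u \<subseteq> carrier B \<times> carrier C" for u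
    using that by (auto simp: carrier_V)
  \<comment> \<open>Induction on the free abelian group has a step for differences, whereas P is
    preserved by sums; carrying the negative along turns a difference into a sum.\<close>
  have "P (coset z) \<and> P (\<ominus>\<^bsub>V\<^esub> coset z)"
    using z(1)
  proof (induction rule: free_Abelian_group_induct[consumes 1])
    case 1
    show ?case
      using pure[of "\<zero>\<^bsub>B\<^esub>" "\<zero>\<^bsub>C\<^esub>"] by (simp add: V.a_inv_zero flip: zero_V)
  next
    case (2 u v)
    have "coset (u - v) \<oplus>\<^bsub>V\<^esub> coset v = coset u"
      using 2 by (simp add: add_coset keys_diff_subset)
    moreover have "coset (u - v) \<in> carrier V" "coset v \<in> carrier V"
      using 2 by (simp_all only: cs keys_diff_subset)
    ultimately have eq: "coset (u - v) = coset u \<oplus>\<^bsub>V\<^esub> \<ominus>\<^bsub>V\<^esub> coset v"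
      by (metis V.a_assoc V.a_inv_closed V.r_neg V.r_zero)
    show ?case
      unfolding eq using 2 cs[of u] cs[of v] by (simp add: V.minus_add add)
  next
    case (3 a)
    then show ?case
      using pure pure_minus_left
      by (cases a) (metis B.M.a_inv_closed SigmaE2 pure_tensor_def)
  qed
  then show ?thesis
    using z by simp
qed

text \<open>The map f extends from the generators to the free group, kills the three kinds of
  relations and hence K, and so factors through cosets. The target is a mere abelian group:
  balancedness is the only trace of the scalars. Only existence is stated; identities between such
  maps are obtained by \<open>tensor_induct\<close>.\<close>

lemma tensor_universal:
  assumes "abelian_group M"
    and closed: "\<And>b c. b \<in> carrier B \<Longrightarrow> c \<in> carrier C \<Longrightarrow> f b c \<in> carrier M"
    and left: "\<And>b b' c. b \<in> carrier B \<Longrightarrow> b' \<in> carrier B \<Longrightarrow> c \<in> carrier C \<Longrightarrow>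
        f (b \<oplus>\<^bsub>B\<^esub> b') c = f b c \<oplus>\<^bsub>M\<^esub> f b' c"
    and right: "\<And>b c c'. b \<in> carrier B \<Longrightarrow> c \<in> carrier C \<Longrightarrow> c' \<in> carrier C \<Longrightarrow>
        f b (c \<oplus>\<^bsub>C\<^esub> c') = f b c \<oplus>\<^bsub>M\<^esub> f b c'"
    and balanced: "\<And>r b c. r \<in> carrier F \<Longrightarrow> b \<in> carrier B \<Longrightarrow> c \<in> carrier C \<Longrightarrow>
        f (r \<odot>\<^bsub>B\<^esub> b) c = f b (r \<odot>\<^bsub>C\<^esub> c)"
  obtains h where "h \<in> hom (add_monoid V) (add_monoid M)"
    and "\<And>b c. b \<in> carrier B \<Longrightarrow> c \<in> carrier C \<Longrightarrow> h (b \<boxtimes> c) = f b c"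
proof -
  interpret M: abelian_group M
    by fact
  let ?G = "tensor_free B C"
  have "case_prod f ` (carrier B \<times> carrier C) \<subseteq> carrier (add_monoid M)"
    using closed by auto
  then obtain h where h: "h \<in> hom ?G (add_monoid M)"
    and h_of: "\<And>x. x \<in> carrier B \<times> carrier C \<Longrightarrow> h (frag_of x) = case_prod f x"
    using comm_group.free_Abelian_group_universal[OF M.a_comm_group] by metis
  interpret h: group_hom ?G "add_monoid M" h
    using h by (simp add: group_hom_def group_hom_axioms_def M.a_group)
  have h_add: "h (x + y) = h x \<oplus>\<^bsub>M\<^esub> h y"
    if "Poly_Mapping.keys x \<subseteq> carrier B \<times> carrier C" "Poly_Mapping.keys y \<subseteq> carrier B \<times> carrier C" for x y
    using h.hom_mult[of x y] that by simp
  have h_closed: "h x \<in> carrier M" if "Poly_Mapping.keys x \<subseteq> carrier B \<times> carrier C" for x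
    using h.hom_closed[of x] that by simp
  have h_minus: "h (- x) = \<ominus>\<^bsub>M\<^esub> h x" if "Poly_Mapping.keys x \<subseteq> carrier B \<times> carrier C" for x
    using h.hom_inv[of x] that by (simp add: a_inv_def)
  have h_diff: "h (x - y) = h x \<ominus>\<^bsub>M\<^esub> h y"
    if "Poly_Mapping.keys x \<subseteq> carrier B \<times> carrier C" "Poly_Mapping.keys y \<subseteq> carrier B \<times> carrier C" for x y
    using h_add[of x "- y"] h_minus[of y] that by (simp add: a_minus_def)
  have cancel: "x \<oplus>\<^bsub>M\<^esub> (y \<oplus>\<^bsub>M\<^esub> (\<ominus>\<^bsub>M\<^esub> x \<oplus>\<^bsub>M\<^esub> \<ominus>\<^bsub>M\<^esub> y)) = \<zero>\<^bsub>M\<^esub>"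
    if "x \<in> carrier M" "y \<in> carrier M" for x y
    using M.r_neg[of "x \<oplus>\<^bsub>M\<^esub> y"] that by (simp add: M.minus_add M.a_assoc)
  have h_rel: "h x = \<zero>\<^bsub>M\<^esub>" if "x \<in> tensor_relations F B C" for x
    using that
    by (cases rule: relations_cases)
      (simp_all add: h_diff h_of keys_diff_subset closed left right balanced
        a_minus_def M.r_neg M.minus_add M.a_assoc cancel)
  have h_ker: "h x = \<zero>\<^bsub>M\<^esub>" if "x \<in> K" for x
    using that unfolding tensor_kernel_def
  proof (induction rule: generate.induct)
    case (inv x)
    then show ?case
      using h_rel[OF inv] h_minus[of x] subsetD[OF relations_closed inv] by (simp add: M.a_inv_zero)
  next
    case (eng x y)
    then show ?case
      using h_add[of x y] kernel_keys[of x] kernel_keys[of y] by (simp add: tensor_kernel_def)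
  qed (use h.hom_one h_rel in auto)
  have "h x = h y" if "x \<in> carrier ?G" "y \<in> carrier ?G" "coset x = coset y" for x y
    using h_add[of "x - y" y] h_ker[OF coset_eqD[OF that(3)]] that
    by (simp add: keys_diff_subset h_closed)
  then obtain g where g: "g \<in> hom (?G Mod K) (add_monoid M)"
    and gh: "\<And>x. x \<in> carrier ?G \<Longrightarrow> g (coset x) = h x"
    using FactGroup_universal[OF h kernel_normal] by metis
  have "g \<in> hom (add_monoid V) (add_monoid M)"
    using g by (simp add: hom_def V_def tensor_algebra_def)
  moreover have "g (b \<boxtimes> c) = f b c" if "b \<in> carrier B" "c \<in> carrier C" for b c
    using that by (simp add: pure_tensor_def gh h_of)
  ultimately show thesis
    using that by blast
qed

section \<open>Scalar multiplication on the quotient\<close>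

lemma smult_coset:
  assumes r: "r \<in> carrier F"
  shows "r \<odot>\<^bsub>V\<^esub> coset x = coset (frag_extend (\<lambda>(b, c). frag_of (r \<odot>\<^bsub>B\<^esub> b, c)) x)"
    (is "_ = coset (?\<phi> x)")
proof -
  \<comment> \<open>Multiplying left factors by r is an endomorphism of the free group. It preserves
    K because it sends each generating relation to a relation of the same kind.\<close>
  have rel: "?\<phi> k \<in> K" if "k \<in> tensor_relations F B C" for k
  proof -
    have "?\<phi> k \<in> tensor_relations F B C"
      using that
    proof (cases rule: relations_cases)
      case (left b b' c)
      then show ?thesis
        using r by (simp add: frag_extend_diff B.smult_r_distr relationsI)
    next
      case (right b c c')
      then show ?thesis
        using r by (simp add: frag_extend_diff relationsI)
    next
      case (balanced s b c)
      \<comment> \<open>The image of the relation for s is (r (s b), c) - (r b, s c). It is the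
        balanced relation of s and r b only after r and s are exchanged, which uses commutativity of
        F.\<close>
      moreover from this have "r \<odot>\<^bsub>B\<^esub> (s \<odot>\<^bsub>B\<^esub> b) = s \<odot>\<^bsub>B\<^esub> (r \<odot>\<^bsub>B\<^esub> b)"
        using r by (metis B.R.m_comm B.smult_assoc1)
      ultimately show ?thesis
        using r by (simp add: frag_extend_diff relationsI)
    qed
    then show ?thesis
      unfolding tensor_kernel_def by (rule generate.incl)
  qed
  have ker: "?\<phi> k \<in> K" if "k \<in> K" for k
    using that unfolding tensor_kernel_def
  proof (induction rule: generate.induct)
    case (inv k)
    then show ?case
      using rel[OF inv] relations_closed kernel_minus
      by (auto simp: frag_extend_minus subset_iff simp flip: tensor_kernel_def)
  next
    case (eng k l)
    then show ?case
      using kernel_add by (auto simp: frag_extend_add simp flip: tensor_kernel_def)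
  qed (use kernel_zero rel in \<open>auto simp flip: tensor_kernel_def\<close>)
  \<comment> \<open>The image of a coset need not be a full coset (for r = 0 all left entries become
    0), which is why the definition adds K back. Since K is mapped into K, the result is exactly one
    coset.\<close>
  have "r \<odot>\<^bsub>V\<^esub> coset x = {k + ?\<phi> (l + x) | k l. k \<in> K \<and> l \<in> K}"
    unfolding V_def tensor_algebra_def by (auto simp: set_mult_def coset_eq)
  also have "\<dots> = coset (?\<phi> x)"
  proof (intro equalityI subsetI)
    fix y assume "y \<in> {k + ?\<phi> (l + x) | k l. k \<in> K \<and> l \<in> K}"
    then obtain k l where "y = (k + ?\<phi> l) + ?\<phi> x" "k \<in> K" "l \<in> K"
      by (auto simp: frag_extend_add add.assoc)
    then show "y \<in> coset (?\<phi> x)"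
      using ker kernel_add by (auto simp: coset_eq)
  next
    fix y assume "y \<in> coset (?\<phi> x)"
    then obtain k where "y = k + ?\<phi> (0 + x)" "k \<in> K"
      by (auto simp: coset_eq)
    then show "y \<in> {k + ?\<phi> (l + x) | k l. k \<in> K \<and> l \<in> K}"
      using kernel_zero by blast
  qed
  finally show ?thesis .
qed

lemma smult_pure:
  "r \<in> carrier F \<Longrightarrow> b \<in> carrier B \<Longrightarrow> c \<in> carrier C \<Longrightarrow> r \<odot>\<^bsub>V\<^esub> (b \<boxtimes> c) = (r \<odot>\<^bsub>B\<^esub> b) \<boxtimes> c"
  by (simp add: pure_tensor_def smult_coset)

text \<open>Additivity comes before the other module laws because their proofs by
  \<open>tensor_induct\<close> need it in the step for sums; it is therefore read off from
  cosets.\<close>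

lemma smult_hom:
  assumes r: "r \<in> carrier F"
  shows "(\<lambda>x. r \<odot>\<^bsub>V\<^esub> x) \<in> hom (add_monoid V) (add_monoid V)"
proof -
  let ?\<phi> = "frag_extend (\<lambda>(b, c). frag_of (r \<odot>\<^bsub>B\<^esub> b, c))"
  have keys: "Poly_Mapping.keys (?\<phi> k) \<subseteq> carrier B \<times> carrier C"
    if "Poly_Mapping.keys k \<subseteq> carrier B \<times> carrier C" for k
    using keys_frag_extend that r by fastforce
  show ?thesis
    using keys by (auto intro!: homI simp: carrier_V smult_coset r add_coset keys_add_subset frag_extend_add)
qed

lemma module_V: "module F V"
proof (rule moduleI)
  show closed: "r \<odot>\<^bsub>V\<^esub> x \<in> carrier V" if "r \<in> carrier F" "x \<in> carrier V" for r x
    using hom_in_carrier[OF smult_hom[OF that(1)], of x] that by simp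
  show distr: "r \<odot>\<^bsub>V\<^esub> (x \<oplus>\<^bsub>V\<^esub> y) = r \<odot>\<^bsub>V\<^esub> x \<oplus>\<^bsub>V\<^esub> r \<odot>\<^bsub>V\<^esub> y"
    if "r \<in> carrier F" "x \<in> carrier V" "y \<in> carrier V" for r x y
    using hom_mult[OF smult_hom[OF that(1)], of x y] that by simp
  fix a b x
  assume a: "a \<in> carrier F" and b: "b \<in> carrier F" and x: "x \<in> carrier V"
  show "(a \<oplus>\<^bsub>F\<^esub> b) \<odot>\<^bsub>V\<^esub> x = a \<odot>\<^bsub>V\<^esub> x \<oplus>\<^bsub>V\<^esub> b \<odot>\<^bsub>V\<^esub> x"
    using x by (induction rule: tensor_induct)
      (simp_all add: a b smult_pure B.smult_l_distr pure_add_left distr closed V.a_ac)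
  show "(a \<otimes>\<^bsub>F\<^esub> b) \<odot>\<^bsub>V\<^esub> x = a \<odot>\<^bsub>V\<^esub> (b \<odot>\<^bsub>V\<^esub> x)"
    using x by (induction rule: tensor_induct)
      (simp_all add: a b smult_pure B.smult_assoc1 distr closed)
next
  fix x assume "x \<in> carrier V"
  then show "\<one>\<^bsub>F\<^esub> \<odot>\<^bsub>V\<^esub> x = x"
  proof (induction rule: tensor_induct)
    case (add x y)
    have "\<one>\<^bsub>F\<^esub> \<odot>\<^bsub>V\<^esub> (x \<oplus>\<^bsub>V\<^esub> y) = \<one>\<^bsub>F\<^esub> \<odot>\<^bsub>V\<^esub> x \<oplus>\<^bsub>V\<^esub> \<one>\<^bsub>F\<^esub> \<odot>\<^bsub>V\<^esub> y"
      using hom_mult[OF smult_hom[of "\<one>\<^bsub>F\<^esub>"], of x y] add by simp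
    with add show ?case by simp
  qed (simp add: smult_pure)
qed (rule B.R.is_cring abelian_group_V)+

sublocale V: module F V
  by (rule module_V)

end

section \<open>Linear functionals\<close>

text \<open>Zorn's lemma in place of a basis: if W is maximal among the submodules that avoid x,
  then A is the direct sum of W and F x, and l reads off the coefficient of x.\<close>

lemma exists_functional:
  assumes "field F" and "module F A" and x: "x \<in> carrier A" "x \<noteq> \<zero>\<^bsub>A\<^esub>"
  obtains l where "\<And>y. y \<in> carrier A \<Longrightarrow> l y \<in> carrier F"
    and "\<And>y z. y \<in> carrier A \<Longrightarrow> z \<in> carrier A \<Longrightarrow> l (y \<oplus>\<^bsub>A\<^esub> z) = l y \<oplus>\<^bsub>F\<^esub> l z"
    and "\<And>r y. r \<in> carrier F \<Longrightarrow> y \<in> carrier A \<Longrightarrow> l (r \<odot>\<^bsub>A\<^esub> y) = r \<otimes>\<^bsub>F\<^esub> l y"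
    and "l x = \<one>\<^bsub>F\<^esub>"
proof -
  interpret F: field F by fact
  interpret A: module F A by fact
  let ?WW = "{W. submodule W F A \<and> x \<notin> W}"
  have "\<exists>W\<in>?WW. \<forall>X\<in>?WW. W \<subseteq> X \<longrightarrow> X = W"
  proof (rule subset_Zorn_nonempty)
    have "submodule {\<zero>\<^bsub>A\<^esub>} F A"
      by (rule A.submoduleI) (auto simp: A.M.a_inv_zero)
    then show "?WW \<noteq> {}"
      using x by blast
    fix \<C> assume ne: "\<C> \<noteq> {}" and chain: "subset.chain ?WW \<C>"
    then have sub: "submodule W F A" "x \<notin> W" if "W \<in> \<C>" for W
      using that by (auto simp: subset.chain_def)
    have "submodule (\<Union>\<C>) F A"
    proof (rule A.submoduleI)
      show "\<Union>\<C> \<subseteq> carrier A"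
        using A.submoduleE(1)[OF sub(1)] by blast
      show "\<zero>\<^bsub>A\<^esub> \<in> \<Union>\<C>"
        using ne sub(1) A.submoduleE(2) subgroup.one_closed[OF submodule.axioms(1)] by fastforce
      show "\<ominus>\<^bsub>A\<^esub> a \<in> \<Union>\<C>" if "a \<in> \<Union>\<C>" for a
        using that A.submoduleE(3)[OF sub(1)] by blast
      show "r \<odot>\<^bsub>A\<^esub> a \<in> \<Union>\<C>" if "r \<in> carrier F" "a \<in> \<Union>\<C>" for r a
        using that A.submoduleE(4)[OF sub(1)] by blast
      fix a b assume "a \<in> \<Union>\<C>" "b \<in> \<Union>\<C>"
      then obtain X Y where XY: "X \<in> \<C>" "Y \<in> \<C>" "a \<in> X" "b \<in> Y"
        by blast
      then have "X \<subseteq> Y \<or> Y \<subseteq> X"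
        using chain by (auto simp: subset.chain_def)
      then obtain Z where "Z \<in> \<C>" "a \<in> Z" "b \<in> Z"
        using XY by blast
      then show "a \<oplus>\<^bsub>A\<^esub> b \<in> \<Union>\<C>"
        using A.submoduleE(5)[OF sub(1)] by blast
    qed
    then show "\<Union>\<C> \<in> ?WW"
      using sub(2) by blast
  qed
  then obtain W where W: "submodule W F A" "x \<notin> W"
    and max: "\<And>X. submodule X F A \<Longrightarrow> x \<notin> X \<Longrightarrow> W \<subseteq> X \<Longrightarrow> X = W"
    by blast
  note WE = A.submoduleE[OF W(1)]
  have zero: "\<zero>\<^bsub>A\<^esub> \<in> W"
    using subgroup.one_closed[OF submodule.axioms(1)[OF W(1)]] by simp
  have WA: "w \<in> carrier A" if "w \<in> W" for w
    using that WE(1) by blast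
  have ex: "\<exists>r\<in>carrier F. \<exists>w\<in>W. y = w \<oplus>\<^bsub>A\<^esub> r \<odot>\<^bsub>A\<^esub> x" if y: "y \<in> carrier A" for y
  proof (cases "y \<in> W")
    case True
    then show ?thesis
      using y x by (intro bexI[of _ "\<zero>\<^bsub>F\<^esub>"] bexI[of _ y]) auto
  next
    case False
    \<comment> \<open>X is W + F y. It properly contains W, so by maximality it contains x, and x =
      w + r y can be solved for y.\<close>
    define X where "X = {w \<oplus>\<^bsub>A\<^esub> r \<odot>\<^bsub>A\<^esub> y | w r. w \<in> W \<and> r \<in> carrier F}"
    have XI: "w \<oplus>\<^bsub>A\<^esub> r \<odot>\<^bsub>A\<^esub> y \<in> X" if "w \<in> W" "r \<in> carrier F" for w r
      using that unfolding X_def by blast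
    have XE: "\<exists>w r. a = w \<oplus>\<^bsub>A\<^esub> r \<odot>\<^bsub>A\<^esub> y \<and> w \<in> W \<and> r \<in> carrier F" if "a \<in> X" for a
      using that unfolding X_def by blast
    have "submodule X F A"
    proof (rule A.submoduleI)
      show "X \<subseteq> carrier A"
        using WA y unfolding X_def by auto
      show "\<zero>\<^bsub>A\<^esub> \<in> X"
        using XI[OF zero F.zero_closed] y by simp
      show sm: "s \<odot>\<^bsub>A\<^esub> a \<in> X" if "s \<in> carrier F" "a \<in> X" for s a
      proof -
        obtain w r where a: "a = w \<oplus>\<^bsub>A\<^esub> r \<odot>\<^bsub>A\<^esub> y" "w \<in> W" "r \<in> carrier F"
          using XE \<open>a \<in> X\<close> by blast
        then have "s \<odot>\<^bsub>A\<^esub> a = s \<odot>\<^bsub>A\<^esub> w \<oplus>\<^bsub>A\<^esub> (s \<otimes>\<^bsub>F\<^esub> r) \<odot>\<^bsub>A\<^esub> y"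
          using that y WA by (simp add: A.smult_r_distr A.smult_assoc1)
        then show ?thesis
          using XI[of "s \<odot>\<^bsub>A\<^esub> w" "s \<otimes>\<^bsub>F\<^esub> r"] a that WE(4) by simp
      qed
      show "\<ominus>\<^bsub>A\<^esub> a \<in> X" if "a \<in> X" for a
        using sm[of "\<ominus>\<^bsub>F\<^esub> \<one>\<^bsub>F\<^esub>" a] that \<open>X \<subseteq> carrier A\<close> by (simp add: A.smult_l_minus subsetD)
      show "a \<oplus>\<^bsub>A\<^esub> b \<in> X" if "a \<in> X" "b \<in> X" for a b
      proof -
        obtain w r where a: "a = w \<oplus>\<^bsub>A\<^esub> r \<odot>\<^bsub>A\<^esub> y" "w \<in> W" "r \<in> carrier F"
          using XE \<open>a \<in> X\<close> by blast
        obtain v s where b: "b = v \<oplus>\<^bsub>A\<^esub> s \<odot>\<^bsub>A\<^esub> y" "v \<in> W" "s \<in> carrier F"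
          using XE \<open>b \<in> X\<close> by blast
        have "a \<oplus>\<^bsub>A\<^esub> b = (w \<oplus>\<^bsub>A\<^esub> v) \<oplus>\<^bsub>A\<^esub> (r \<oplus>\<^bsub>F\<^esub> s) \<odot>\<^bsub>A\<^esub> y"
          using a b y WA by (simp add: A.smult_l_distr A.M.a_ac)
        then show ?thesis
          using XI a b WE(5) by simp
      qed
    qed
    moreover have "W \<subseteq> X"
    proof
      fix w assume "w \<in> W"
      then show "w \<in> X"
        using XI[OF _ F.zero_closed, of w] y WA by simp
    qed
    moreover have "y \<in> X"
      using XI[OF zero F.one_closed] y by simp
    ultimately have "x \<in> X"
      using max[of X] False by blast
    then obtain w r where xw: "x = w \<oplus>\<^bsub>A\<^esub> r \<odot>\<^bsub>A\<^esub> y" "w \<in> W" "r \<in> carrier F"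
      using XE by blast
    \<comment> \<open>For r = 0 the element x = w would lie in W.\<close>
    then have "r \<noteq> \<zero>\<^bsub>F\<^esub>"
      using W(2) y WA by auto
    then have r: "inv\<^bsub>F\<^esub> r \<in> carrier F" "inv\<^bsub>F\<^esub> r \<otimes>\<^bsub>F\<^esub> r = \<one>\<^bsub>F\<^esub>"
      using xw(3) by (simp_all add: F.field_Units)
    have "inv\<^bsub>F\<^esub> r \<odot>\<^bsub>A\<^esub> x = inv\<^bsub>F\<^esub> r \<odot>\<^bsub>A\<^esub> w \<oplus>\<^bsub>A\<^esub> (inv\<^bsub>F\<^esub> r \<otimes>\<^bsub>F\<^esub> r) \<odot>\<^bsub>A\<^esub> y"
      unfolding xw(1) using xw r(1) y WA by (simp add: A.smult_r_distr A.smult_assoc1)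
    then have "inv\<^bsub>F\<^esub> r \<odot>\<^bsub>A\<^esub> x = inv\<^bsub>F\<^esub> r \<odot>\<^bsub>A\<^esub> w \<oplus>\<^bsub>A\<^esub> y"
      using y r(2) by simp
    then have "y = \<ominus>\<^bsub>A\<^esub> (inv\<^bsub>F\<^esub> r \<odot>\<^bsub>A\<^esub> w) \<oplus>\<^bsub>A\<^esub> inv\<^bsub>F\<^esub> r \<odot>\<^bsub>A\<^esub> x"
      using y r(1) WA[OF xw(2)] by (simp add: A.M.r_neg1)
    moreover have "\<ominus>\<^bsub>A\<^esub> (inv\<^bsub>F\<^esub> r \<odot>\<^bsub>A\<^esub> w) \<in> W"
      using WE(3,4) xw(2) r(1) by simp
    ultimately show ?thesis
      using r(1) by blast
  qed
  \<comment> \<open>Otherwise (r - s) x lies in W, and dividing by r - s puts x into W.\<close>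
  have uniq: "r = s"
    if r: "r \<in> carrier F" and s: "s \<in> carrier F" and w: "w \<in> W" and v: "v \<in> W"
      and eq: "w \<oplus>\<^bsub>A\<^esub> r \<odot>\<^bsub>A\<^esub> x = v \<oplus>\<^bsub>A\<^esub> s \<odot>\<^bsub>A\<^esub> x" for r s w v
  proof (rule ccontr)
    let ?q = "r \<oplus>\<^bsub>F\<^esub> \<ominus>\<^bsub>F\<^esub> s"
    assume "r \<noteq> s"
    then have "?q \<noteq> \<zero>\<^bsub>F\<^esub>"
      using r s F.minus_equality F.minus_minus by (metis F.add.inv_closed)
    then have q: "?q \<in> carrier F" "inv\<^bsub>F\<^esub> ?q \<in> carrier F" "inv\<^bsub>F\<^esub> ?q \<otimes>\<^bsub>F\<^esub> ?q = \<one>\<^bsub>F\<^esub>"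
      using r s by (simp_all add: F.field_Units)
    have "?q \<odot>\<^bsub>A\<^esub> x = r \<odot>\<^bsub>A\<^esub> x \<oplus>\<^bsub>A\<^esub> \<ominus>\<^bsub>A\<^esub> (s \<odot>\<^bsub>A\<^esub> x)"
      using r s x by (simp add: A.smult_l_distr A.smult_l_minus)
    also have "r \<odot>\<^bsub>A\<^esub> x = \<ominus>\<^bsub>A\<^esub> w \<oplus>\<^bsub>A\<^esub> (v \<oplus>\<^bsub>A\<^esub> s \<odot>\<^bsub>A\<^esub> x)"
      unfolding eq[symmetric] using WA[OF w] r x by (simp add: A.M.r_neg1)
    also have "\<ominus>\<^bsub>A\<^esub> w \<oplus>\<^bsub>A\<^esub> (v \<oplus>\<^bsub>A\<^esub> s \<odot>\<^bsub>A\<^esub> x) \<oplus>\<^bsub>A\<^esub> \<ominus>\<^bsub>A\<^esub> (s \<odot>\<^bsub>A\<^esub> x) = \<ominus>\<^bsub>A\<^esub> w \<oplus>\<^bsub>A\<^esub> v"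
      using WA[OF w] WA[OF v] s x by (simp add: A.M.a_assoc A.M.r_neg)
    finally have "?q \<odot>\<^bsub>A\<^esub> x \<in> W"
      using WE(3,5) w v by simp
    then have "inv\<^bsub>F\<^esub> ?q \<odot>\<^bsub>A\<^esub> (?q \<odot>\<^bsub>A\<^esub> x) \<in> W"
      using WE(4) q by simp
    moreover have "inv\<^bsub>F\<^esub> ?q \<odot>\<^bsub>A\<^esub> (?q \<odot>\<^bsub>A\<^esub> x) = x"
      using q x by (simp flip: A.smult_assoc1)
    ultimately show False
      using W(2) by simp
  qed
  \<comment> \<open>By \<open>ex\<close> and \<open>uniq\<close> the coefficient r exists and is
    unique, so every property of l reduces to writing its argument as w + r x and applying
    \<open>l_eq\<close>.\<close>
  define l where "l y = (THE r. r \<in> carrier F \<and> (\<exists>w\<in>W. y = w \<oplus>\<^bsub>A\<^esub> r \<odot>\<^bsub>A\<^esub> x))" for y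
  have l_eq: "l (w \<oplus>\<^bsub>A\<^esub> r \<odot>\<^bsub>A\<^esub> x) = r" if "r \<in> carrier F" "w \<in> W" for r w
    unfolding l_def using that uniq by (intro the_equality) blast+
  show thesis
  proof
    fix y assume y: "y \<in> carrier A"
    then obtain r w where yr: "y = w \<oplus>\<^bsub>A\<^esub> r \<odot>\<^bsub>A\<^esub> x" "r \<in> carrier F" "w \<in> W"
      using ex by blast
    then have ly: "l y = r"
      using l_eq by simp
    then show "l y \<in> carrier F"
      using yr by simp
    show "l (q \<odot>\<^bsub>A\<^esub> y) = q \<otimes>\<^bsub>F\<^esub> l y" if q: "q \<in> carrier F" for q
    proof -
      have "q \<odot>\<^bsub>A\<^esub> y = q \<odot>\<^bsub>A\<^esub> w \<oplus>\<^bsub>A\<^esub> (q \<otimes>\<^bsub>F\<^esub> r) \<odot>\<^bsub>A\<^esub> x"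
        using yr q x WA by (simp add: A.smult_r_distr A.smult_assoc1)
      then show ?thesis
        using l_eq[of "q \<otimes>\<^bsub>F\<^esub> r" "q \<odot>\<^bsub>A\<^esub> w"] yr q WE(4) ly by simp
    qed
    fix z assume z: "z \<in> carrier A"
    then obtain s v where zs: "z = v \<oplus>\<^bsub>A\<^esub> s \<odot>\<^bsub>A\<^esub> x" "s \<in> carrier F" "v \<in> W"
      using ex by blast
    have "y \<oplus>\<^bsub>A\<^esub> z = (w \<oplus>\<^bsub>A\<^esub> v) \<oplus>\<^bsub>A\<^esub> (r \<oplus>\<^bsub>F\<^esub> s) \<odot>\<^bsub>A\<^esub> x"
      using yr zs x WA by (simp add: A.smult_l_distr A.M.a_ac)
    then show "l (y \<oplus>\<^bsub>A\<^esub> z) = l y \<oplus>\<^bsub>F\<^esub> l z"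
      using l_eq[of "r \<oplus>\<^bsub>F\<^esub> s" "w \<oplus>\<^bsub>A\<^esub> v"] l_eq[of s v] yr zs WE(5) ly by simp
  next
    show "l x = \<one>\<^bsub>F\<^esub>"
      using l_eq[OF F.one_closed zero] x by simp
  qed
qed


section \<open>Maps out of graded algebras\<close>

context graded_algebra
begin

lemma component_closed: "s \<in> carrier S \<Longrightarrow> x \<in> D s \<Longrightarrow> x \<in> carrier A"
  using submoduleE(1)[OF component_submodule] by blast

lemma component_zero: "s \<in> carrier S \<Longrightarrow> \<zero>\<^bsub>A\<^esub> \<in> D s"
  using subgroup.one_closed[OF submodule.axioms(1)[OF component_submodule]] by simp

lemma component_add: "s \<in> carrier S \<Longrightarrow> x \<in> D s \<Longrightarrow> y \<in> D s \<Longrightarrow> x \<oplus>\<^bsub>A\<^esub> y \<in> D s"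
  using submoduleE(5)[OF component_submodule] by blast

lemma component_minus: "s \<in> carrier S \<Longrightarrow> x \<in> D s \<Longrightarrow> \<ominus>\<^bsub>A\<^esub> x \<in> D s"
  using submoduleE(3)[OF component_submodule] by blast

lemma component_smult: "s \<in> carrier S \<Longrightarrow> r \<in> carrier F \<Longrightarrow> x \<in> D s \<Longrightarrow> r \<odot>\<^bsub>A\<^esub> x \<in> D s"
  using submoduleE(4)[OF component_submodule] by blast

text \<open>\<open>coeff x s\<close> is the homogeneous component of x in degree s, an element of A
  and not a scalar.\<close>

definition coeff
  where "coeff x = (THE f. f \<in> (\<Pi>\<^sub>E s\<in>carrier S. D s) \<and> finite {s \<in> carrier S. f s \<noteq> \<zero>\<^bsub>A\<^esub>} \<and>
             x = finsum A f {s \<in> carrier S. f s \<noteq> \<zero>\<^bsub>A\<^esub>})"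

abbreviation supp where "supp f \<equiv> {s \<in> carrier S. f s \<noteq> \<zero>\<^bsub>A\<^esub>}"

lemma coeff:
  assumes "x \<in> carrier A"
  shows "coeff x \<in> (\<Pi>\<^sub>E s\<in>carrier S. D s)" "finite (supp (coeff x))"
    "x = finsum A (coeff x) (supp (coeff x))"
  using theI'[OF decomposition[OF assms]] unfolding coeff_def by blast+

lemma coeff_closed: "x \<in> carrier A \<Longrightarrow> s \<in> carrier S \<Longrightarrow> coeff x s \<in> D s"
  using coeff(1) by blast

lemma finsum_supp:
  assumes "finite J" "J \<subseteq> carrier S" "\<And>s. s \<in> carrier S \<Longrightarrow> f s \<in> D s"
    and "\<And>s. s \<in> carrier S \<Longrightarrow> s \<notin> J \<Longrightarrow> f s = \<zero>\<^bsub>A\<^esub>"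
  shows "finsum A f (supp f) = finsum A f J"
  by (rule M.add.finprod_mono_neutral_cong_left)
    (use assms component_closed in \<open>auto intro!: finite_subset[of "supp f" J]\<close>)

text \<open>Uniqueness of the decomposition in usable form: J may be any finite set of degrees
  containing the support, so the exact support, which can shrink in a sum, never has to be
  computed.\<close>

lemma coeffI:
  assumes J: "finite J" "J \<subseteq> carrier S" and f: "\<And>s. s \<in> carrier S \<Longrightarrow> f s \<in> D s"
    and 0: "\<And>s. s \<in> carrier S \<Longrightarrow> s \<notin> J \<Longrightarrow> f s = \<zero>\<^bsub>A\<^esub>"
    and x: "x = finsum A f J" and s: "s \<in> carrier S"
  shows "coeff x s = f s"
proof -
  \<comment> \<open>\<open>decomposition\<close> speaks of families that are extensional on
    \<open>carrier S\<close>, so f is cut down before uniqueness is applied.\<close>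
  let ?f = "restrict f (carrier S)"
  have supp: "supp ?f = supp f"
    by auto
  have "f s \<in> carrier A" if "s \<in> carrier S" for s
    using f component_closed that by blast
  then have "finsum A ?f (supp f) = finsum A f (supp f)"
    by (intro M.finsum_cong') auto
  also have "\<dots> = x"
    unfolding x by (rule finsum_supp[OF J f 0])
  finally have sum: "x = finsum A ?f (supp ?f)"
    unfolding supp ..
  have "finite (supp f)"
    using 0 by (intro finite_subset[OF _ J(1)]) auto
  moreover have "x \<in> carrier A"
    unfolding x using f J(2) component_closed by (intro M.finsum_closed) blast
  moreover have "?f \<in> (\<Pi>\<^sub>E s\<in>carrier S. D s)"
    using f by auto
  ultimately have "coeff x = ?f"
    unfolding coeff_def using sum supp by (intro the1_equality[OF decomposition] conjI) simp_all
  then show ?thesis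
    using s by simp
qed

lemma coeff_homogeneous:
  assumes "s \<in> carrier S" "x \<in> D s" "t \<in> carrier S"
  shows "coeff x t = (if t = s then x else \<zero>\<^bsub>A\<^esub>)"
  by (rule coeffI[where J = "{s}"]) (use assms component_zero component_closed in auto)

lemma coeff_finsum:
  assumes "x \<in> carrier A" "finite J" "supp (coeff x) \<subseteq> J" "J \<subseteq> carrier S"
  shows "x = finsum A (coeff x) J"
  using coeff(3)[OF assms(1)] finsum_supp[of J "coeff x"] coeff_closed[OF assms(1)] assms(2-)
  by auto

lemma coeff_add:
  assumes x: "x \<in> carrier A" and y: "y \<in> carrier A" and s: "s \<in> carrier S"
  shows "coeff (x \<oplus>\<^bsub>A\<^esub> y) s = coeff x s \<oplus>\<^bsub>A\<^esub> coeff y s"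
proof (rule coeffI[where J = "supp (coeff x) \<union> supp (coeff y)", OF _ _ _ _ _ s])
  let ?J = "supp (coeff x) \<union> supp (coeff y)"
  have J: "finite ?J" "?J \<subseteq> carrier S"
    using coeff(2) x y by auto
  then show "finite ?J" "?J \<subseteq> carrier S" .
  have cl: "coeff x \<in> ?J \<rightarrow> carrier A" "coeff y \<in> ?J \<rightarrow> carrier A"
    using coeff_closed x y component_closed by blast+
  have "x = finsum A (coeff x) ?J" "y = finsum A (coeff y) ?J"
    using coeff_finsum[OF x J(1) _ J(2)] coeff_finsum[OF y J(1) _ J(2)] by blast+
  then show "x \<oplus>\<^bsub>A\<^esub> y = (\<Oplus>\<^bsub>A\<^esub>s\<in>?J. coeff x s \<oplus>\<^bsub>A\<^esub> coeff y s)"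
    using M.finsum_addf[OF cl] by simp
qed (use coeff_closed x y component_add in auto)

lemma graded_induct [consumes 1, case_names homogeneous add]:
  assumes x: "x \<in> carrier A"
    and hom: "\<And>s x. s \<in> carrier S \<Longrightarrow> x \<in> D s \<Longrightarrow> P x"
    and add: "\<And>x y. x \<in> carrier A \<Longrightarrow> y \<in> carrier A \<Longrightarrow> P x \<Longrightarrow> P y \<Longrightarrow> P (x \<oplus>\<^bsub>A\<^esub> y)"
  shows "P x"
proof -
  have "P (finsum A (coeff x) J)" if "finite J" "J \<subseteq> carrier S" for J
    using that
  proof (induction J rule: finite_induct)
    case empty
    show ?case
      \<comment> \<open>Zero is homogeneous of every degree; the identity is the one degree that is
        certain to exist.\<close>
      using hom[OF S.one_closed component_zero] by simp
  next
    case (insert s J)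
    then have "coeff x s \<in> carrier A" "coeff x \<in> J \<rightarrow> carrier A"
      using coeff_closed x component_closed by blast+
    then show ?case
      using insert hom[of s "coeff x s"] coeff_closed[OF x, of s]
      by (simp add: add M.finsum_closed)
  qed
  then show ?thesis
    using coeff[OF x] by (metis (no_types, lifting) mem_Collect_eq subsetI)
qed

lemma coeff_smult:
  assumes x: "x \<in> carrier A" and r: "r \<in> carrier F" and s: "s \<in> carrier S"
  shows "coeff (r \<odot>\<^bsub>A\<^esub> x) s = r \<odot>\<^bsub>A\<^esub> coeff x s"
  using x
proof (induction rule: graded_induct)
  case (homogeneous t x)
  then show ?case
    using r s by (simp add: coeff_homogeneous component_smult)
next
  case (add x y)
  then show ?case
    using r s by (simp add: smult_r_distr coeff_add component_closed[OF s coeff_closed])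
qed

text \<open>The map h sums the values of g on the homogeneous components. Additivity needs one
  finite set of degrees that serves x, y and x + y at once; \<open>h_eq\<close> permits this because
  additivity of \<open>g s\<close> forces it to vanish at 0.\<close>

lemma graded_universal:
  assumes "abelian_group M"
    and closed: "\<And>s x. s \<in> carrier S \<Longrightarrow> x \<in> D s \<Longrightarrow> g s x \<in> carrier M"
    and add: "\<And>s x y. s \<in> carrier S \<Longrightarrow> x \<in> D s \<Longrightarrow> y \<in> D s \<Longrightarrow>
        g s (x \<oplus>\<^bsub>A\<^esub> y) = g s x \<oplus>\<^bsub>M\<^esub> g s y"
  obtains h where "h \<in> hom (add_monoid A) (add_monoid M)"
    and "\<And>s x. s \<in> carrier S \<Longrightarrow> x \<in> D s \<Longrightarrow> h x = g s x"
proof -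
  interpret N: abelian_group M
    by fact
  define h where "h x = finsum M (\<lambda>s. g s (coeff x s)) (supp (coeff x))" for x
  have zero: "g s \<zero>\<^bsub>A\<^esub> = \<zero>\<^bsub>M\<^esub>" if "s \<in> carrier S" for s
    using add[OF that component_zero component_zero] closed[OF that component_zero] that
    by (simp add: N.add.l_cancel_one')
  have cl: "(\<lambda>s. g s (coeff x s)) \<in> carrier S \<rightarrow> carrier M" if "x \<in> carrier A" for x
    using closed coeff_closed[OF that] by blast
  have h_eq: "h x = finsum M (\<lambda>s. g s (coeff x s)) J"
    if "x \<in> carrier A" "finite J" "supp (coeff x) \<subseteq> J" "J \<subseteq> carrier S" for x J
    unfolding h_def
  proof (rule N.add.finprod_mono_neutral_cong_left)
    show "g s (coeff x s) = \<zero>\<^bsub>M\<^esub>" if "s \<in> J - supp (coeff x)" for s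
      using that \<open>J \<subseteq> carrier S\<close> zero by auto
  qed (use that cl[OF that(1)] in auto)
  have "h \<in> hom (add_monoid A) (add_monoid M)"
  proof (rule homI)
    show "h x \<in> carrier (add_monoid M)" if "x \<in> carrier (add_monoid A)" for x
      unfolding h_def using cl[of x] that by (auto intro!: N.finsum_closed)
    fix x y assume "x \<in> carrier (add_monoid A)" "y \<in> carrier (add_monoid A)"
    then have xy: "x \<in> carrier A" "y \<in> carrier A"
      by simp_all
    let ?J = "supp (coeff x) \<union> supp (coeff y)"
    have J: "finite ?J" "?J \<subseteq> carrier S"
      using coeff(2) xy by auto
    have xyJ: "(\<lambda>s. g s (coeff x s)) \<in> ?J \<rightarrow> carrier M" "(\<lambda>s. g s (coeff y s)) \<in> ?J \<rightarrow> carrier M"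
      using cl xy by blast+
    have "h (x \<oplus>\<^bsub>A\<^esub> y) = finsum M (\<lambda>s. g s (coeff (x \<oplus>\<^bsub>A\<^esub> y) s)) ?J"
      using xy J by (intro h_eq) (auto simp: coeff_add)
    also have "\<dots> = (\<Oplus>\<^bsub>M\<^esub>s\<in>?J. g s (coeff x s) \<oplus>\<^bsub>M\<^esub> g s (coeff y s))"
      using xyJ xy by (intro N.finsum_cong') (auto simp: coeff_add coeff_closed add)
    also have "\<dots> = h x \<oplus>\<^bsub>M\<^esub> h y"
      using N.finsum_addf[OF xyJ] h_eq[OF xy(1) J(1) _ J(2)] h_eq[OF xy(2) J(1) _ J(2)] by simp
    finally show "h (x \<otimes>\<^bsub>add_monoid A\<^esub> y) = h x \<otimes>\<^bsub>add_monoid M\<^esub> h y"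
      by simp
  qed
  moreover have "h x = g s x" if "s \<in> carrier S" "x \<in> D s" for s x
  proof -
    have "h x = finsum M (\<lambda>t. g t (coeff x t)) {s}"
      using that by (intro h_eq) (auto simp: component_closed coeff_homogeneous split: if_splits)
    then show ?thesis
      using that by (simp add: coeff_homogeneous closed)
  qed
  ultimately show thesis
    using that by blast
qed

end

section \<open>Graded tensor products\<close>

abbreviation add_hom where "add_hom A M \<equiv> hom (add_monoid A) (add_monoid M)"

lemma add_hom_closed: "h \<in> add_hom A M \<Longrightarrow> x \<in> carrier A \<Longrightarrow> h x \<in> carrier M"
  by (auto simp: hom_def)

lemma add_hom_add: "h \<in> add_hom A M \<Longrightarrow> x \<in> carrier A \<Longrightarrow> y \<in> carrier A \<Longrightarrow>
    h (x \<oplus>\<^bsub>A\<^esub> y) = h x \<oplus>\<^bsub>M\<^esub> h y"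
  by (auto simp: hom_def)

lemma (in module) smult_left_commute:
  "a \<in> carrier R \<Longrightarrow> b \<in> carrier R \<Longrightarrow> x \<in> carrier M \<Longrightarrow>
    a \<odot>\<^bsub>M\<^esub> (b \<odot>\<^bsub>M\<^esub> x) = b \<odot>\<^bsub>M\<^esub> (a \<odot>\<^bsub>M\<^esub> x)"
  by (metis R.m_comm smult_assoc1)

locale graded_tensor = B: graded_algebra F S B DB + C: graded_algebra F T C DC
  for F :: "('f, 'n) ring_scheme"
    and S :: "('s, 'k) monoid_scheme" and T :: "('t, 'l) monoid_scheme"
    and B :: "('f, 'b, 'p) module_scheme" and DB :: "'s \<Rightarrow> 'b set"
    and C :: "('f, 'c, 'q) module_scheme" and DC :: "'t \<Rightarrow> 'c set" +
  fixes \<alpha> :: "'s \<Rightarrow> 't \<Rightarrow> 'f"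
  assumes pairing: "\<alpha> \<in> pairings S T F"
begin

sublocale tensor_product F B C ..

section \<open>The pairing, and induction on homogeneous pure tensors\<close>

lemma pairing_closed [simp]: "s \<in> carrier S \<Longrightarrow> t \<in> carrier T \<Longrightarrow> \<alpha> s t \<in> carrier F"
  using pairing by (auto simp: pairings_def)

lemma pairing_mult:
  "s \<in> carrier S \<Longrightarrow> s' \<in> carrier S \<Longrightarrow> t \<in> carrier T \<Longrightarrow> \<alpha> (s \<otimes>\<^bsub>S\<^esub> s') t = \<alpha> s t \<otimes>\<^bsub>F\<^esub> \<alpha> s' t"
  "s \<in> carrier S \<Longrightarrow> t \<in> carrier T \<Longrightarrow> t' \<in> carrier T \<Longrightarrow> \<alpha> s (t \<otimes>\<^bsub>T\<^esub> t') = \<alpha> s t \<otimes>\<^bsub>F\<^esub> \<alpha> s t'"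
  using pairing by (auto simp: pairings_def)

lemma pairing_Units: "s \<in> carrier S \<Longrightarrow> t \<in> carrier T \<Longrightarrow> \<alpha> s t \<in> Units F"
  using pairing by (auto simp: pairings_def)

text \<open>Multiplicativity gives \<alpha>(1, t) = \<alpha>(1, t) \<alpha>(1, t), and an invertible
  idempotent is 1; likewise in the other variable.\<close>

lemma pairing_one:
  "t \<in> carrier T \<Longrightarrow> \<alpha> \<one>\<^bsub>S\<^esub> t = \<one>\<^bsub>F\<^esub>"
  "s \<in> carrier S \<Longrightarrow> \<alpha> s \<one>\<^bsub>T\<^esub> = \<one>\<^bsub>F\<^esub>"
proof -
  have idem: "u = \<one>\<^bsub>F\<^esub>" if "u \<in> Units F" "u = u \<otimes>\<^bsub>F\<^esub> u" for u
    using that B.F.Units_l_cancel[of u u "\<one>\<^bsub>F\<^esub>"] B.F.Units_closed[of u]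
    by (metis B.F.one_closed B.F.r_one)
  show "\<alpha> \<one>\<^bsub>S\<^esub> t = \<one>\<^bsub>F\<^esub>" if "t \<in> carrier T"
    using idem[OF pairing_Units[of "\<one>\<^bsub>S\<^esub>" t]] pairing_mult(1)[of "\<one>\<^bsub>S\<^esub>" "\<one>\<^bsub>S\<^esub>" t] that by simp
  show "\<alpha> s \<one>\<^bsub>T\<^esub> = \<one>\<^bsub>F\<^esub>" if "s \<in> carrier S"
    using idem[OF pairing_Units[of s "\<one>\<^bsub>T\<^esub>"]] pairing_mult(2)[of s "\<one>\<^bsub>T\<^esub>" "\<one>\<^bsub>T\<^esub>"] that by simp
qed

lemma graded_tensor_induct [consumes 1, case_names pure add]:
  assumes "x \<in> carrier V"
    and pure: "\<And>s t b c. s \<in> carrier S \<Longrightarrow> t \<in> carrier T \<Longrightarrow> b \<in> DB s \<Longrightarrow> c \<in> DC t \<Longrightarrow> P (b \<boxtimes> c)"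
    and add: "\<And>x y. x \<in> carrier V \<Longrightarrow> y \<in> carrier V \<Longrightarrow> P x \<Longrightarrow> P y \<Longrightarrow> P (x \<oplus>\<^bsub>V\<^esub> y)"
  shows "P x"
  using assms(1)
proof (induction rule: tensor_induct)
  case (pure b c)
  from pure(1) show ?case
  proof (induction rule: B.graded_induct)
    case (homogeneous s b)
    from pure(2) show ?case
    proof (induction rule: C.graded_induct)
      case (homogeneous t c)
      then show ?case
        using assms(2) \<open>s \<in> carrier S\<close> \<open>b \<in> DB s\<close> by blast
    next
      case (add c c')
      have "b \<in> carrier B"
        using B.component_closed \<open>s \<in> carrier S\<close> \<open>b \<in> DB s\<close> by blast
      with add show ?case
        by (simp add: pure_add_right assms(3))
    qed
  next
    case (add b b')
    then show ?case
      using pure(2) by (simp add: pure_add_left assms(3))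
  qed
qed (rule assms(3))


subsection \<open>The grading\<close>

abbreviation W where "W \<equiv> tensor_grading F B DB C DC"

lemma W_pure: "b \<in> DB s \<Longrightarrow> c \<in> DC t \<Longrightarrow> b \<boxtimes> c \<in> W (s, t)"
  unfolding tensor_grading_def by (auto intro: generate.incl)

lemma W_add: "x \<in> W q \<Longrightarrow> y \<in> W q \<Longrightarrow> x \<oplus>\<^bsub>V\<^esub> y \<in> W q"
  using generate.eng[of x "tensor_free B C Mod K" _ y]
  by (cases q) (simp add: tensor_grading_def V_def tensor_algebra_def)

text \<open>Zero and the negatives of the generators are pure tensors with factors in the same two
  components, so pure tensors and sums exhaust the generated subgroup.\<close>

lemma W_induct [consumes 3, case_names pure add]:
  assumes x: "x \<in> W (s, t)" and s: "s \<in> carrier S" and t: "t \<in> carrier T"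
    and pure: "\<And>b c. b \<in> DB s \<Longrightarrow> c \<in> DC t \<Longrightarrow> P (b \<boxtimes> c)"
    and add: "\<And>x y. x \<in> W (s, t) \<Longrightarrow> y \<in> W (s, t) \<Longrightarrow> x \<in> carrier V \<Longrightarrow> y \<in> carrier V \<Longrightarrow>
        P x \<Longrightarrow> P y \<Longrightarrow> P (x \<oplus>\<^bsub>V\<^esub> y)"
  shows "P x"
proof -
  let ?Q = "tensor_free B C Mod K"
  let ?H = "{b \<boxtimes> c | b c. b \<in> DB s \<and> c \<in> DC t}"
  have W: "W (s, t) = generate ?Q ?H"
    by (simp add: tensor_grading_def)
  \<comment> \<open>Membership in V is carried along because the case for sums assumes it, while
    \<open>W_closed\<close> is itself proved by this rule.\<close>
  have "x \<in> carrier V \<and> P x"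
    using x unfolding W
  proof (induction rule: generate.induct)
    case one
    have "\<zero>\<^bsub>B\<^esub> \<boxtimes> \<zero>\<^bsub>C\<^esub> = \<one>\<^bsub>?Q\<^esub>"
      by (simp add: V_def tensor_algebra_def)
    then show ?case
      using pure[OF B.component_zero[OF s] C.component_zero[OF t]]
        pure_closed[of "\<zero>\<^bsub>B\<^esub>" "\<zero>\<^bsub>C\<^esub>"] by simp
  next
    case (incl h)
    then show ?case
      using pure B.component_closed[OF s] C.component_closed[OF t] by blast
  next
    case (inv h)
    then obtain b c where h: "h = b \<boxtimes> c" "b \<in> DB s" "c \<in> DC t"
      by blast
    then have "inv\<^bsub>?Q\<^esub> h = (\<ominus>\<^bsub>B\<^esub> b) \<boxtimes> c"
      using B.component_closed[OF s] C.component_closed[OF t] by (simp add: pure_minus_left a_inv_V)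
    then show ?case
      using pure[OF B.component_minus[OF s] h(3)] h B.component_closed[OF s] C.component_closed[OF t]
      by simp
  next
    case (eng x y)
    moreover have "x \<otimes>\<^bsub>?Q\<^esub> y = x \<oplus>\<^bsub>V\<^esub> y"
      by (simp add: V_def tensor_algebra_def)
    ultimately show ?case
      using add unfolding W by (simp del: mult_FactGroup)
  qed
  then show ?thesis ..
qed

lemma W_closed:
  assumes "q \<in> carrier (S \<times>\<times> T)" "x \<in> W q"
  shows "x \<in> carrier V"
proof -
  obtain s t where q: "q = (s, t)" "s \<in> carrier S" "t \<in> carrier T"
    using assms(1) by auto
  show ?thesis
    using assms(2)[unfolded q(1)] q(2,3)
  proof (induction rule: W_induct)
    case (pure b c)
    then show ?case
      using B.component_closed[OF q(2)] C.component_closed[OF q(3)] by simp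
  qed simp
qed

lemma W_zero:
  assumes "q \<in> carrier (S \<times>\<times> T)"
  shows "\<zero>\<^bsub>V\<^esub> \<in> W q"
proof -
  obtain s t where q: "q = (s, t)" "s \<in> carrier S" "t \<in> carrier T"
    using assms by auto
  show ?thesis
    using W_pure[OF B.component_zero[OF q(2)] C.component_zero[OF q(3)]] q by simp
qed

lemma W_smult:
  assumes q: "q \<in> carrier (S \<times>\<times> T)" and r: "r \<in> carrier F" and x: "x \<in> W q"
  shows "r \<odot>\<^bsub>V\<^esub> x \<in> W q"
proof -
  obtain s t where q: "q = (s, t)" "s \<in> carrier S" "t \<in> carrier T"
    using q by auto
  show ?thesis
    using x[unfolded q(1)] q(2,3) unfolding q(1)
  proof (induction rule: W_induct)
    case (pure b c)
    then show ?case
      using q r by (simp add: smult_pure W_pure B.component_smult B.component_closed C.component_closed)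
  next
    case (add x y)
    then show ?case
      using r by (simp add: V.smult_r_distr W_add)
  qed
qed

lemma W_submodule:
  assumes q: "q \<in> carrier (S \<times>\<times> T)"
  shows "submodule (W q) F V"
proof (rule V.submoduleI)
  show "\<ominus>\<^bsub>V\<^esub> x \<in> W q" if "x \<in> W q" for x
    using W_smult[OF q _ that, of "\<ominus>\<^bsub>F\<^esub> \<one>\<^bsub>F\<^esub>"] W_closed[OF q that] by (simp add: V.smult_l_minus)
qed (use q W_closed W_zero W_add W_smult in auto)

section \<open>Projections onto the components of B \<otimes> C\<close>

lemma projection_exists:
  assumes s: "s \<in> carrier S" and t: "t \<in> carrier T"
  obtains p where "p \<in> add_hom V V"
    and "\<And>b c. b \<in> carrier B \<Longrightarrow> c \<in> carrier C \<Longrightarrow> p (b \<boxtimes> c) = B.coeff b s \<boxtimes> C.coeff c t"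
proof (rule tensor_universal[of V "\<lambda>b c. B.coeff b s \<boxtimes> C.coeff c t"])
  have cB: "B.coeff b s \<in> carrier B" if "b \<in> carrier B" for b
    using B.component_closed[OF s B.coeff_closed[OF that s]] .
  have cC: "C.coeff c t \<in> carrier C" if "c \<in> carrier C" for c
    using C.component_closed[OF t C.coeff_closed[OF that t]] .
  show "B.coeff b s \<boxtimes> C.coeff c t \<in> carrier V" if "b \<in> carrier B" "c \<in> carrier C" for b c
    using that cB cC by simp
  show "B.coeff (b \<oplus>\<^bsub>B\<^esub> b') s \<boxtimes> C.coeff c t = B.coeff b s \<boxtimes> C.coeff c t \<oplus>\<^bsub>V\<^esub> B.coeff b' s \<boxtimes> C.coeff c t"
    if "b \<in> carrier B" "b' \<in> carrier B" "c \<in> carrier C" for b b' c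
    using that cB cC s by (simp add: B.coeff_add pure_add_left)
  show "B.coeff b s \<boxtimes> C.coeff (c \<oplus>\<^bsub>C\<^esub> c') t = B.coeff b s \<boxtimes> C.coeff c t \<oplus>\<^bsub>V\<^esub> B.coeff b s \<boxtimes> C.coeff c' t"
    if "b \<in> carrier B" "c \<in> carrier C" "c' \<in> carrier C" for b c c'
    using that cB cC t by (simp add: C.coeff_add pure_add_right)
  show "B.coeff (r \<odot>\<^bsub>B\<^esub> b) s \<boxtimes> C.coeff c t = B.coeff b s \<boxtimes> C.coeff (r \<odot>\<^bsub>C\<^esub> c) t"
    if "r \<in> carrier F" "b \<in> carrier B" "c \<in> carrier C" for r b c
    using that cB cC s t by (simp add: C.coeff_smult B.coeff_smult pure_balanced)
qed (use abelian_group_V that in blast)+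

text \<open>The map \<open>p q\<close> is the tensor product of the two component projections. It is
  the identity on \<open>W q\<close> and zero on all other components. Existence is the identity x =
  sum of \<open>p q x\<close> over finitely many q, checked on homogeneous pure tensors; uniqueness
  follows by applying \<open>p q\<close> to an arbitrary decomposition.\<close>

lemma W_decomposition:
  assumes x: "x \<in> carrier V"
  shows "\<exists>!f. f \<in> (\<Pi>\<^sub>E q\<in>carrier (S \<times>\<times> T). W q) \<and> finite {q \<in> carrier (S \<times>\<times> T). f q \<noteq> \<zero>\<^bsub>V\<^esub>} \<and>
             x = finsum V f {q \<in> carrier (S \<times>\<times> T). f q \<noteq> \<zero>\<^bsub>V\<^esub>}"
proof -
  let ?I = "carrier (S \<times>\<times> T)"
  have "\<exists>p. p \<in> add_hom V V \<and> (\<forall>b\<in>carrier B. \<forall>c\<in>carrier C. p (b \<boxtimes> c) = B.coeff b (fst q) \<boxtimes> C.coeff c (snd q))"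
    if "q \<in> ?I" for q
  proof -
    have "fst q \<in> carrier S" "snd q \<in> carrier T"
      using that by auto
    then obtain p where "p \<in> add_hom V V"
      "\<And>b c. b \<in> carrier B \<Longrightarrow> c \<in> carrier C \<Longrightarrow> p (b \<boxtimes> c) = B.coeff b (fst q) \<boxtimes> C.coeff c (snd q)"
      by (rule projection_exists) (rule that)
    then show ?thesis
      by (intro exI[of _ p]) simp
  qed
  then have "\<exists>p. \<forall>q\<in>?I. p q \<in> add_hom V V \<and>
      (\<forall>b\<in>carrier B. \<forall>c\<in>carrier C. p q (b \<boxtimes> c) = B.coeff b (fst q) \<boxtimes> C.coeff c (snd q))"
    by (intro bchoice) simp
  then obtain p where P: "\<forall>q\<in>?I. p q \<in> add_hom V V \<and>
      (\<forall>b\<in>carrier B. \<forall>c\<in>carrier C. p q (b \<boxtimes> c) = B.coeff b (fst q) \<boxtimes> C.coeff c (snd q))"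
    by (rule exE)
  have p: "p q \<in> add_hom V V" if "q \<in> ?I" for q
    using bspec[OF P that] by (rule conjunct1)
  have p_pure: "p q (b \<boxtimes> c) = B.coeff b (fst q) \<boxtimes> C.coeff c (snd q)"
    if "q \<in> ?I" "b \<in> carrier B" "c \<in> carrier C" for q b c
    using bspec[OF P that(1)] that(2,3) by simp
  note p_closed = add_hom_closed[OF p] and p_add = add_hom_add[OF p]
  have p_zero: "p q \<zero>\<^bsub>V\<^esub> = \<zero>\<^bsub>V\<^esub>" if "q \<in> ?I" for q
    using p_add[OF that, of "\<zero>\<^bsub>V\<^esub>" "\<zero>\<^bsub>V\<^esub>"] p_closed[OF that, of "\<zero>\<^bsub>V\<^esub>"] by (simp add: V.add.l_cancel_one')
  \<comment> \<open>A homogeneous factor has only one nonzero component, and a pure tensor with a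
    zero factor vanishes; so \<open>p q\<close> keeps a pure tensor only if both of its degrees
    match q.\<close>
  have p_W: "p q x = (if q' = q then x else \<zero>\<^bsub>V\<^esub>)" if q: "q \<in> ?I" "q' \<in> ?I" "x \<in> W q'" for q q' x
  proof -
    obtain s t where st: "q' = (s, t)" "s \<in> carrier S" "t \<in> carrier T"
      using q(2) by auto
    have q0: "fst q \<in> carrier S" "snd q \<in> carrier T"
      using q(1) by auto
    show ?thesis
      using q(3)[unfolded st(1)] st(2,3)
    proof (induction rule: W_induct)
      case (pure b c)
      then show ?case
        using st q0 q(1)
        by (auto simp: p_pure B.component_closed C.component_closed B.coeff_homogeneous C.coeff_homogeneous
            prod_eq_iff)
    next
      case (add x y)
      then show ?case
        using q(1) by (auto simp: p_add)
    qed
  qed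
  have p_in_W: "p q x \<in> W q" if "q \<in> ?I" "x \<in> carrier V" for q x
    using that(2)
  proof (induction rule: tensor_induct)
    case (pure b c)
    then have "B.coeff b (fst q) \<boxtimes> C.coeff c (snd q) \<in> W (fst q, snd q)"
      using that(1) by (intro W_pure B.coeff_closed C.coeff_closed) auto
    then show ?case
      using pure that(1) by (simp add: p_pure)
  qed (use that(1) in \<open>simp add: p_add W_add\<close>)
  have finsum_p: "finsum V (\<lambda>q. p q x) {q \<in> ?I. p q x \<noteq> \<zero>\<^bsub>V\<^esub>} = finsum V (\<lambda>q. p q x) J"
    if "finite J" "J \<subseteq> ?I" "\<And>q. q \<in> ?I \<Longrightarrow> q \<notin> J \<Longrightarrow> p q x = \<zero>\<^bsub>V\<^esub>" "x \<in> carrier V" for J x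
    by (rule V.add.finprod_mono_neutral_cong_left) (use that p_closed in auto)
  \<comment> \<open>J may exceed the set of q with nonzero \<open>p q x\<close>: for a sum the union
    of the two sets serves, whatever cancels.\<close>
  have "\<exists>J. finite J \<and> J \<subseteq> ?I \<and> (\<forall>q\<in>?I. q \<notin> J \<longrightarrow> p q x = \<zero>\<^bsub>V\<^esub>) \<and> x = finsum V (\<lambda>q. p q x) J"
    using x
  proof (induction rule: graded_tensor_induct)
    case (pure s t b c)
    then have bc: "(s, t) \<in> ?I" "b \<boxtimes> c \<in> W (s, t)"
      by (auto intro: W_pure)
    have eq: "p q (b \<boxtimes> c) = (if (s, t) = q then b \<boxtimes> c else \<zero>\<^bsub>V\<^esub>)" if "q \<in> ?I" for q
      by (rule p_W[OF that bc])
    have "finsum V (\<lambda>q. p q (b \<boxtimes> c)) {(s, t)} = b \<boxtimes> c"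
      using W_closed[OF bc] by (simp add: eq[OF bc(1)])
    moreover have "\<forall>q\<in>?I. q \<notin> {(s, t)} \<longrightarrow> p q (b \<boxtimes> c) = \<zero>\<^bsub>V\<^esub>"
      using eq by simp
    ultimately show ?case
      using bc(1) by (intro exI[of _ "{(s, t)}"]) simp
  next
    case (add x y)
    then obtain J J' where J: "finite J" "J \<subseteq> ?I" "\<forall>q\<in>?I. q \<notin> J \<longrightarrow> p q x = \<zero>\<^bsub>V\<^esub>" "x = finsum V (\<lambda>q. p q x) J"
      and J': "finite J'" "J' \<subseteq> ?I" "\<forall>q\<in>?I. q \<notin> J' \<longrightarrow> p q y = \<zero>\<^bsub>V\<^esub>" "y = finsum V (\<lambda>q. p q y) J'"
      by blast
    note xy = add.hyps(1,2)
    have "finsum V (\<lambda>q. p q x) J = finsum V (\<lambda>q. p q x) (J \<union> J')"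
      by (rule V.add.finprod_mono_neutral_cong_left) (use J(1-3) J'(1-3) xy p_closed in auto)
    moreover have "finsum V (\<lambda>q. p q y) J' = finsum V (\<lambda>q. p q y) (J \<union> J')"
      by (rule V.add.finprod_mono_neutral_cong_left) (use J(1-3) J'(1-3) xy p_closed in auto)
    moreover have "finsum V (\<lambda>q. p q (x \<oplus>\<^bsub>V\<^esub> y)) (J \<union> J') = finsum V (\<lambda>q. p q x \<oplus>\<^bsub>V\<^esub> p q y) (J \<union> J')"
      using J(1-3) J'(1-3) xy p_closed by (intro V.finsum_cong') (auto simp: p_add)
    moreover have "\<dots> = finsum V (\<lambda>q. p q x) (J \<union> J') \<oplus>\<^bsub>V\<^esub> finsum V (\<lambda>q. p q y) (J \<union> J')"
      using J(1-3) J'(1-3) xy p_closed by (intro V.finsum_addf) auto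
    ultimately have "x \<oplus>\<^bsub>V\<^esub> y = finsum V (\<lambda>q. p q (x \<oplus>\<^bsub>V\<^esub> y)) (J \<union> J')"
      using J(4) J'(4) by simp
    then show ?case
      using J(1-3) J'(1-3) xy by (intro exI[of _ "J \<union> J'"]) (auto simp: p_add)
  qed
  then obtain J where J: "finite J" "J \<subseteq> ?I" "\<forall>q\<in>?I. q \<notin> J \<longrightarrow> p q x = \<zero>\<^bsub>V\<^esub>" "x = finsum V (\<lambda>q. p q x) J"
    by blast
  let ?f = "\<lambda>q\<in>?I. p q x"
  have supp: "{q \<in> ?I. ?f q \<noteq> \<zero>\<^bsub>V\<^esub>} = {q \<in> ?I. p q x \<noteq> \<zero>\<^bsub>V\<^esub>}"
    by auto
  show ?thesis
  proof (rule ex1I[of _ ?f], intro conjI)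
    show "?f \<in> (\<Pi>\<^sub>E q\<in>?I. W q)"
      using p_in_W x by auto
    show "finite {q \<in> ?I. ?f q \<noteq> \<zero>\<^bsub>V\<^esub>}"
      unfolding supp using J(1,3) by (intro finite_subset[OF _ J(1)]) auto
    have "finsum V ?f {q \<in> ?I. p q x \<noteq> \<zero>\<^bsub>V\<^esub>} = finsum V (\<lambda>q. p q x) {q \<in> ?I. p q x \<noteq> \<zero>\<^bsub>V\<^esub>}"
      using p_closed x by (intro V.finsum_cong') auto
    then show "x = finsum V ?f {q \<in> ?I. ?f q \<noteq> \<zero>\<^bsub>V\<^esub>}"
      unfolding supp using finsum_p[of J x] J x by simp
  next
    fix f
    assume f: "f \<in> (\<Pi>\<^sub>E q\<in>?I. W q) \<and> finite {q \<in> ?I. f q \<noteq> \<zero>\<^bsub>V\<^esub>} \<and> x = finsum V f {q \<in> ?I. f q \<noteq> \<zero>\<^bsub>V\<^esub>}"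
    then have fW: "f q \<in> W q" if "q \<in> ?I" for q
      using that by blast
    \<comment> \<open>Applying \<open>p q\<close> to a decomposition isolates its value at q.
      Membership of partial sums in V is carried along because additivity of \<open>p q\<close>
      requires it.\<close>
    have p_sum: "p q (finsum V f J) = (if q \<in> J then f q else \<zero>\<^bsub>V\<^esub>) \<and> finsum V f J \<in> carrier V"
      if "q \<in> ?I" "finite J" "J \<subseteq> ?I" for q J
      using that(2,3)
    proof (induction J rule: finite_induct)
      case (insert i J)
      then have "f i \<in> carrier V" "f \<in> J \<rightarrow> carrier V"
        using fW W_closed by blast+
      moreover have "p q (f i) = (if i = q then f i else \<zero>\<^bsub>V\<^esub>)"
        using insert.prems by (intro p_W[OF that(1)] fW) simp_all
      moreover have "p q (finsum V f J) = (if q \<in> J then f q else \<zero>\<^bsub>V\<^esub>)" "finsum V f J \<in> carrier V"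
        using insert.IH insert.prems by simp_all
      moreover have "q \<in> J \<Longrightarrow> f q \<in> carrier V"
        using insert.prems fW W_closed by blast
      ultimately show ?case
        using insert.hyps by (cases "i = q") (simp_all add: p_add[OF that(1)])
    qed (simp add: p_zero[OF that(1)])
    have "p q x = f q" if "q \<in> ?I" for q
      using p_sum[OF that, of "{q \<in> ?I. f q \<noteq> \<zero>\<^bsub>V\<^esub>}"] f that by auto
    then show "f = ?f"
      using f by (intro PiE_ext[of f ?I W ?f]) (auto simp: p_in_W x)
  qed
qed

end

context graded_tensor
begin

subsection \<open>The multiplication\<close>

text \<open>\<open>twist s\<close> is what moving \<open>c\<close> past an element of degree \<open>s\<close> does to \<open>c\<close>.  In \<open>x (b' \<boxtimes> c')\<close>, the
  map \<open>rmul\<close> extends the defining formula from pure tensors to all \<open>x\<close>, then \<open>lmul\<close> from homogeneous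
  \<open>b'\<close> to all \<open>b'\<close>, and \<open>tmul\<close> from \<open>b' \<boxtimes> c'\<close> to all tensors.\<close>

definition twist where
  "twist s = (SOME h. h \<in> add_hom C C \<and> (\<forall>t\<in>carrier T. \<forall>c\<in>DC t. h c = \<alpha> s t \<odot>\<^bsub>C\<^esub> c))"

lemma twist_spec:
  assumes s: "s \<in> carrier S"
  shows "twist s \<in> add_hom C C \<and> (\<forall>t\<in>carrier T. \<forall>c\<in>DC t. twist s c = \<alpha> s t \<odot>\<^bsub>C\<^esub> c)"
proof -
  have "\<exists>h. h \<in> add_hom C C \<and> (\<forall>t\<in>carrier T. \<forall>c\<in>DC t. h c = \<alpha> s t \<odot>\<^bsub>C\<^esub> c)"
  proof (rule C.graded_universal[of C "\<lambda>t c. \<alpha> s t \<odot>\<^bsub>C\<^esub> c"])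
    show "\<alpha> s t \<odot>\<^bsub>C\<^esub> c \<in> carrier C" if "t \<in> carrier T" "c \<in> DC t" for t c
      using that s C.component_closed by simp
    show "\<alpha> s t \<odot>\<^bsub>C\<^esub> (c \<oplus>\<^bsub>C\<^esub> c') = \<alpha> s t \<odot>\<^bsub>C\<^esub> c \<oplus>\<^bsub>C\<^esub> \<alpha> s t \<odot>\<^bsub>C\<^esub> c'"
      if "t \<in> carrier T" "c \<in> DC t" "c' \<in> DC t" for t c c'
      using that s C.component_closed by (simp add: C.smult_r_distr)
    fix h assume h: "h \<in> add_hom C C"
      "\<And>t c. t \<in> carrier T \<Longrightarrow> c \<in> DC t \<Longrightarrow> h c = \<alpha> s t \<odot>\<^bsub>C\<^esub> c"
    show ?thesis
      by (intro exI[of _ h]) (simp add: h)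
  qed (rule C.M.abelian_group_axioms)
  then show ?thesis
    unfolding twist_def by (rule someI_ex)
qed

lemma twist_hom: "s \<in> carrier S \<Longrightarrow> twist s \<in> add_hom C C"
  using twist_spec by blast

lemma twist_homogeneous:
  "s \<in> carrier S \<Longrightarrow> t \<in> carrier T \<Longrightarrow> c \<in> DC t \<Longrightarrow> twist s c = \<alpha> s t \<odot>\<^bsub>C\<^esub> c"
  using twist_spec by blast

lemma twist_closed [simp]: "s \<in> carrier S \<Longrightarrow> c \<in> carrier C \<Longrightarrow> twist s c \<in> carrier C"
  by (rule add_hom_closed[OF twist_hom])

lemma twist_add: "s \<in> carrier S \<Longrightarrow> c \<in> carrier C \<Longrightarrow> c' \<in> carrier C \<Longrightarrow>
    twist s (c \<oplus>\<^bsub>C\<^esub> c') = twist s c \<oplus>\<^bsub>C\<^esub> twist s c'"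
  by (rule add_hom_add[OF twist_hom])

text \<open>The universal property of the grading gives only an additive map. Linearity over F is
  what makes the formula for \<open>rmul\<close> balanced; it holds because scalars commute.\<close>

lemma twist_smult:
  assumes s: "s \<in> carrier S" and r: "r \<in> carrier F" and c: "c \<in> carrier C"
  shows "twist s (r \<odot>\<^bsub>C\<^esub> c) = r \<odot>\<^bsub>C\<^esub> twist s c"
  using c
proof (induction rule: C.graded_induct)
  case (homogeneous t c)
  then have "twist s (r \<odot>\<^bsub>C\<^esub> c) = \<alpha> s t \<odot>\<^bsub>C\<^esub> (r \<odot>\<^bsub>C\<^esub> c)"
    using s r by (intro twist_homogeneous C.component_smult)
  then show ?case
    using homogeneous s r C.component_closed
    by (simp add: twist_homogeneous[OF s homogeneous] C.smult_left_commute)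
next
  case (add c c')
  then show ?case
    using s r by (simp add: twist_add C.smult_r_distr)
qed

definition rmul where
  "rmul s b' c' = (SOME h. h \<in> add_hom V V \<and>
    (\<forall>b\<in>carrier B. \<forall>c\<in>carrier C. h (b \<boxtimes> c) = (b \<otimes>\<^bsub>B\<^esub> b') \<boxtimes> (twist s c \<otimes>\<^bsub>C\<^esub> c')))"

lemma rmul_spec:
  assumes s: "s \<in> carrier S" and b': "b' \<in> carrier B" and c': "c' \<in> carrier C"
  shows "rmul s b' c' \<in> add_hom V V \<and>
    (\<forall>b\<in>carrier B. \<forall>c\<in>carrier C. rmul s b' c' (b \<boxtimes> c) = (b \<otimes>\<^bsub>B\<^esub> b') \<boxtimes> (twist s c \<otimes>\<^bsub>C\<^esub> c'))"
proof -
  have "\<exists>h. h \<in> add_hom V V \<and>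
    (\<forall>b\<in>carrier B. \<forall>c\<in>carrier C. h (b \<boxtimes> c) = (b \<otimes>\<^bsub>B\<^esub> b') \<boxtimes> (twist s c \<otimes>\<^bsub>C\<^esub> c'))"
  proof (rule tensor_universal[of V "\<lambda>b c. (b \<otimes>\<^bsub>B\<^esub> b') \<boxtimes> (twist s c \<otimes>\<^bsub>C\<^esub> c')"])
    fix h assume h: "h \<in> add_hom V V"
      "\<And>b c. b \<in> carrier B \<Longrightarrow> c \<in> carrier C \<Longrightarrow> h (b \<boxtimes> c) = (b \<otimes>\<^bsub>B\<^esub> b') \<boxtimes> (twist s c \<otimes>\<^bsub>C\<^esub> c')"
    show ?thesis
      by (intro exI[of _ h]) (simp add: h)
  qed (use s b' c' in \<open>simp_all add: abelian_group_V B.A.l_distr C.A.l_distr twist_add twist_smult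
        pure_add_left pure_add_right B.smult_mult_left C.smult_mult_left pure_balanced\<close>)
  then show ?thesis
    unfolding rmul_def by (rule someI_ex)
qed

lemma rmul_hom:
  "s \<in> carrier S \<Longrightarrow> b' \<in> carrier B \<Longrightarrow> c' \<in> carrier C \<Longrightarrow> rmul s b' c' \<in> add_hom V V"
  using rmul_spec by blast

lemma rmul_pure:
  "s \<in> carrier S \<Longrightarrow> b \<in> carrier B \<Longrightarrow> c \<in> carrier C \<Longrightarrow> b' \<in> carrier B \<Longrightarrow> c' \<in> carrier C \<Longrightarrow>
    rmul s b' c' (b \<boxtimes> c) = (b \<otimes>\<^bsub>B\<^esub> b') \<boxtimes> (twist s c \<otimes>\<^bsub>C\<^esub> c')"
  using rmul_spec by blast

lemma rmul_closed [simp]: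
  "s \<in> carrier S \<Longrightarrow> b' \<in> carrier B \<Longrightarrow> c' \<in> carrier C \<Longrightarrow> x \<in> carrier V \<Longrightarrow> rmul s b' c' x \<in> carrier V"
  by (rule add_hom_closed[OF rmul_hom])

lemma rmul_add:
  "s \<in> carrier S \<Longrightarrow> b' \<in> carrier B \<Longrightarrow> c' \<in> carrier C \<Longrightarrow> x \<in> carrier V \<Longrightarrow> y \<in> carrier V \<Longrightarrow>
    rmul s b' c' (x \<oplus>\<^bsub>V\<^esub> y) = rmul s b' c' x \<oplus>\<^bsub>V\<^esub> rmul s b' c' y"
  by (rule add_hom_add[OF rmul_hom])

text \<open>Here x is fixed and the right factor varies. Additivity in the B argument lets
  \<open>lmul\<close> be defined on all of B; the other two laws are inherited by
  \<open>lmul\<close>, where they become the hypotheses for defining \<open>tmul\<close>.\<close>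

lemma rmul_bilinear:
  assumes s: "s \<in> carrier S" and x: "x \<in> carrier V"
  shows "b \<in> carrier B \<Longrightarrow> b' \<in> carrier B \<Longrightarrow> c \<in> carrier C \<Longrightarrow>
      rmul s (b \<oplus>\<^bsub>B\<^esub> b') c x = rmul s b c x \<oplus>\<^bsub>V\<^esub> rmul s b' c x"
    and "b \<in> carrier B \<Longrightarrow> c \<in> carrier C \<Longrightarrow> c' \<in> carrier C \<Longrightarrow>
      rmul s b (c \<oplus>\<^bsub>C\<^esub> c') x = rmul s b c x \<oplus>\<^bsub>V\<^esub> rmul s b c' x"
    and "r \<in> carrier F \<Longrightarrow> b \<in> carrier B \<Longrightarrow> c \<in> carrier C \<Longrightarrow>
      rmul s (r \<odot>\<^bsub>B\<^esub> b) c x = rmul s b (r \<odot>\<^bsub>C\<^esub> c) x"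
proof -
  show "rmul s (b \<oplus>\<^bsub>B\<^esub> b') c x = rmul s b c x \<oplus>\<^bsub>V\<^esub> rmul s b' c x"
    if "b \<in> carrier B" "b' \<in> carrier B" "c \<in> carrier C"
    using x by (induction rule: tensor_induct)
      (simp_all add: s that rmul_pure rmul_add B.A.r_distr pure_add_left V.a_ac)
  show "rmul s b (c \<oplus>\<^bsub>C\<^esub> c') x = rmul s b c x \<oplus>\<^bsub>V\<^esub> rmul s b c' x"
    if "b \<in> carrier B" "c \<in> carrier C" "c' \<in> carrier C"
    using x by (induction rule: tensor_induct)
      (simp_all add: s that rmul_pure rmul_add C.A.r_distr pure_add_right V.a_ac)
  show "rmul s (r \<odot>\<^bsub>B\<^esub> b) c x = rmul s b (r \<odot>\<^bsub>C\<^esub> c) x"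
    if "r \<in> carrier F" "b \<in> carrier B" "c \<in> carrier C"
    using x by (induction rule: tensor_induct)
      (simp_all add: s that rmul_pure rmul_add B.smult_mult_right C.smult_mult_right pure_balanced)
qed

definition lmul where
  "lmul x c' = (SOME h. h \<in> add_hom B V \<and> (\<forall>s\<in>carrier S. \<forall>b'\<in>DB s. h b' = rmul s b' c' x))"

lemma lmul_spec:
  assumes x: "x \<in> carrier V" and c': "c' \<in> carrier C"
  shows "lmul x c' \<in> add_hom B V \<and> (\<forall>s\<in>carrier S. \<forall>b'\<in>DB s. lmul x c' b' = rmul s b' c' x)"
proof -
  have "\<exists>h. h \<in> add_hom B V \<and> (\<forall>s\<in>carrier S. \<forall>b'\<in>DB s. h b' = rmul s b' c' x)"
  proof (rule B.graded_universal[of V "\<lambda>s b'. rmul s b' c' x"])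
    show "rmul s b' c' x \<in> carrier V" if "s \<in> carrier S" "b' \<in> DB s" for s b'
      using that x c' B.component_closed by simp
    show "rmul s (b \<oplus>\<^bsub>B\<^esub> b') c' x = rmul s b c' x \<oplus>\<^bsub>V\<^esub> rmul s b' c' x"
      if "s \<in> carrier S" "b \<in> DB s" "b' \<in> DB s" for s b b'
      using that x c' B.component_closed by (simp add: rmul_bilinear)
    fix h assume h: "h \<in> add_hom B V"
      "\<And>s b'. s \<in> carrier S \<Longrightarrow> b' \<in> DB s \<Longrightarrow> h b' = rmul s b' c' x"
    show ?thesis
      by (intro exI[of _ h]) (simp add: h)
  qed (rule abelian_group_V)
  then show ?thesis
    unfolding lmul_def by (rule someI_ex)
qed

lemma lmul_hom: "x \<in> carrier V \<Longrightarrow> c' \<in> carrier C \<Longrightarrow> lmul x c' \<in> add_hom B V"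
  using lmul_spec by blast

lemma lmul_homogeneous:
  "x \<in> carrier V \<Longrightarrow> c' \<in> carrier C \<Longrightarrow> s \<in> carrier S \<Longrightarrow> b' \<in> DB s \<Longrightarrow> lmul x c' b' = rmul s b' c' x"
  using lmul_spec by blast

lemma lmul_closed [simp]:
  "x \<in> carrier V \<Longrightarrow> c' \<in> carrier C \<Longrightarrow> b' \<in> carrier B \<Longrightarrow> lmul x c' b' \<in> carrier V"
  by (rule add_hom_closed[OF lmul_hom])

lemma lmul_add:
  "x \<in> carrier V \<Longrightarrow> c' \<in> carrier C \<Longrightarrow> b \<in> carrier B \<Longrightarrow> b' \<in> carrier B \<Longrightarrow>
    lmul x c' (b \<oplus>\<^bsub>B\<^esub> b') = lmul x c' b \<oplus>\<^bsub>V\<^esub> lmul x c' b'"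
  by (rule add_hom_add[OF lmul_hom])

lemma lmul_add_right:
  assumes x: "x \<in> carrier V" and c: "c \<in> carrier C" "c' \<in> carrier C" and b: "b \<in> carrier B"
  shows "lmul x (c \<oplus>\<^bsub>C\<^esub> c') b = lmul x c b \<oplus>\<^bsub>V\<^esub> lmul x c' b"
  using b
proof (induction rule: B.graded_induct)
  case (homogeneous s b)
  then show ?case
    using x c B.component_closed by (simp add: lmul_homogeneous[OF _ _ homogeneous] rmul_bilinear)
next
  case (add b b')
  then show ?case
    using x c by (simp add: lmul_add V.a_ac)
qed

lemma lmul_balanced:
  assumes x: "x \<in> carrier V" and c: "c \<in> carrier C" and r: "r \<in> carrier F" and b: "b \<in> carrier B"
  shows "lmul x c (r \<odot>\<^bsub>B\<^esub> b) = lmul x (r \<odot>\<^bsub>C\<^esub> c) b"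
  using b
proof (induction rule: B.graded_induct)
  case (homogeneous s b)
  then have "lmul x c (r \<odot>\<^bsub>B\<^esub> b) = rmul s (r \<odot>\<^bsub>B\<^esub> b) c x"
    using x c r by (intro lmul_homogeneous B.component_smult)
  then show ?case
    using homogeneous x c r B.component_closed
    by (simp add: lmul_homogeneous[OF _ _ homogeneous] rmul_bilinear)
next
  case (add b b')
  then show ?case
    using x c r by (simp add: lmul_add B.smult_r_distr)
qed

definition tmul where
  "tmul x = (SOME h. h \<in> add_hom V V \<and> (\<forall>b'\<in>carrier B. \<forall>c'\<in>carrier C. h (b' \<boxtimes> c') = lmul x c' b'))"

lemma tmul_spec:
  assumes x: "x \<in> carrier V"
  shows "tmul x \<in> add_hom V V \<and> (\<forall>b'\<in>carrier B. \<forall>c'\<in>carrier C. tmul x (b' \<boxtimes> c') = lmul x c' b')"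
proof -
  have "\<exists>h. h \<in> add_hom V V \<and> (\<forall>b'\<in>carrier B. \<forall>c'\<in>carrier C. h (b' \<boxtimes> c') = lmul x c' b')"
  proof (rule tensor_universal[of V "\<lambda>b' c'. lmul x c' b'"])
    fix h assume h: "h \<in> add_hom V V"
      "\<And>b' c'. b' \<in> carrier B \<Longrightarrow> c' \<in> carrier C \<Longrightarrow> h (b' \<boxtimes> c') = lmul x c' b'"
    show ?thesis
      by (intro exI[of _ h]) (simp add: h)
  qed (use x in \<open>simp_all add: abelian_group_V lmul_add lmul_add_right lmul_balanced\<close>)
  then show ?thesis
    unfolding tmul_def by (rule someI_ex)
qed

lemma tmul_hom: "x \<in> carrier V \<Longrightarrow> tmul x \<in> add_hom V V"
  using tmul_spec by blast

lemma tmul_pure_right: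
  "x \<in> carrier V \<Longrightarrow> s \<in> carrier S \<Longrightarrow> b' \<in> DB s \<Longrightarrow> c' \<in> carrier C \<Longrightarrow>
    tmul x (b' \<boxtimes> c') = rmul s b' c' x"
  using tmul_spec[of x] lmul_homogeneous[of x c' s b'] B.component_closed[of s b'] by simp

text \<open>\<open>tmul x\<close> is additive by construction, but additivity in x has to be proved:
  z is reduced to homogeneous pure tensors, where the product becomes the additive map
  \<open>rmul\<close> applied to x.\<close>

lemma tmul_add_left:
  assumes "x \<in> carrier V" "y \<in> carrier V" "z \<in> carrier V"
  shows "tmul (x \<oplus>\<^bsub>V\<^esub> y) z = tmul x z \<oplus>\<^bsub>V\<^esub> tmul y z"
  using assms(3)
proof (induction rule: graded_tensor_induct)
  case (pure s t b c)
  then show ?case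
    using assms B.component_closed C.component_closed by (simp add: tmul_pure_right rmul_add)
next
  case (add u v)
  then show ?case
    using assms
    by (simp add: add_hom_add[OF tmul_hom] add_hom_closed[OF tmul_hom] V.a_ac)
qed

lemma tmul_pure:
  assumes "b \<in> carrier B" "s \<in> carrier S" "b' \<in> DB s" "t \<in> carrier T" "c \<in> DC t" "c' \<in> carrier C"
  shows "tmul (b \<boxtimes> c) (b' \<boxtimes> c') = \<alpha> s t \<odot>\<^bsub>V\<^esub> ((b \<otimes>\<^bsub>B\<^esub> b') \<boxtimes> (c \<otimes>\<^bsub>C\<^esub> c'))"
proof -
  have cl: "c \<in> carrier C" "b' \<in> carrier B"
    using assms B.component_closed C.component_closed by auto
  have "tmul (b \<boxtimes> c) (b' \<boxtimes> c') = (b \<otimes>\<^bsub>B\<^esub> b') \<boxtimes> (\<alpha> s t \<odot>\<^bsub>C\<^esub> c \<otimes>\<^bsub>C\<^esub> c')"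
    using assms cl by (simp add: tmul_pure_right rmul_pure twist_homogeneous)
  also have "\<dots> = (b \<otimes>\<^bsub>B\<^esub> b') \<boxtimes> (\<alpha> s t \<odot>\<^bsub>C\<^esub> (c \<otimes>\<^bsub>C\<^esub> c'))"
    using assms cl by (simp add: C.smult_mult_left)
  \<comment> \<open>Balancedness carries the scalar from the right factor to the left one, where it
    is the scalar multiplication of the tensor product.\<close>
  also have "\<dots> = \<alpha> s t \<odot>\<^bsub>V\<^esub> ((b \<otimes>\<^bsub>B\<^esub> b') \<boxtimes> (c \<otimes>\<^bsub>C\<^esub> c'))"
    using assms cl by (simp add: smult_pure pure_balanced)
  finally show ?thesis .
qed

end


section \<open>Twisted products\<close>

lemma algebra_hom_image:
  assumes F: "unital_algebra F B" and A: "unital_algebra F A" and h: "h \<in> algebra_hom F B A"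
  shows "unital_subalgebra (h ` carrier B) F A"
proof -
  interpret B: unital_algebra F B by fact
  interpret A: unital_algebra F A by fact
  have hom: "h \<in> ring_hom B A"
    and smult: "\<And>r x. r \<in> carrier F \<Longrightarrow> x \<in> carrier B \<Longrightarrow> h (r \<odot>\<^bsub>B\<^esub> x) = r \<odot>\<^bsub>A\<^esub> h x"
    using h by (auto simp: algebra_hom_def)
  interpret h: ring_hom_ring B A h
    by (rule ring_hom_ringI2[OF B.A.ring_axioms A.A.ring_axioms hom])
  have sub: "subring (h ` carrier B) A"
    by (rule h.img_is_subring[OF B.A.carrier_is_subring])
  have "submodule (h ` carrier B) F A"
  proof (rule A.submoduleI)
    show "h ` carrier B \<subseteq> carrier A"
      by (rule subringE(1)[OF sub])
    show "\<zero>\<^bsub>A\<^esub> \<in> h ` carrier B"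
      by (rule subringE(2)[OF sub])
    show "\<ominus>\<^bsub>A\<^esub> x \<in> h ` carrier B" if "x \<in> h ` carrier B" for x
      by (rule subringE(5)[OF sub that])
    show "x \<oplus>\<^bsub>A\<^esub> y \<in> h ` carrier B" if "x \<in> h ` carrier B" "y \<in> h ` carrier B" for x y
      by (rule subringE(7)[OF sub that])
    fix r x assume r: "r \<in> carrier F" and "x \<in> h ` carrier B"
    then obtain y where y: "y \<in> carrier B" "x = h y"
      by blast
    then show "r \<odot>\<^bsub>A\<^esub> x \<in> h ` carrier B"
      using smult[OF r y(1)] r by (intro image_eqI[of _ h "r \<odot>\<^bsub>B\<^esub> y"]) simp_all
  qed
  with sub show ?thesis
    by (simp add: unital_subalgebra_def)
qed

context tensor_product
begin

text \<open>The group axioms and finite sums depend only on the additive monoid, so this equality of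
  records transfers them from V to every choice of product and unit.\<close>

lemma add_monoid_tensor_algebra: "add_monoid (tensor_algebra F B C m u) = add_monoid V"
  by (simp add: tensor_algebra_simps V_def tensor_algebra_def)

lemma module_tensor_algebra: "module F (tensor_algebra F B C m u)"
proof (rule moduleI)
  show "abelian_group (tensor_algebra F B C m u)"
    using abelian_group_V
    unfolding abelian_group_def abelian_group_axioms_def abelian_monoid_def add_monoid_tensor_algebra .
qed (simp_all add: tensor_algebra_simps B.R.is_cring V.smult_l_distr V.smult_r_distr V.smult_assoc1)

lemma submodule_tensor_algebra:
  "submodule H F (tensor_algebra F B C m u) \<longleftrightarrow> submodule H F V"
  unfolding submodule_def submodule_axioms_def add_monoid_tensor_algebra tensor_algebra_simps ..

lemma finsum_tensor_algebra: "finsum (tensor_algebra F B C m u) f J = finsum V f J"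
  by (simp add: finsum_def add_monoid_tensor_algebra)

end

text \<open>The working characterisation: biadditivity together with the formula. Only b' and c are
  homogeneous, since only their degrees enter \<alpha>. Associativity, the unit and compatibility
  with scalars are derived from this.\<close>

locale twisted_tensor = graded_tensor F S T B DB C DC \<alpha>
  for F :: "('f, 'n) ring_scheme"
    and S :: "('s, 'k) monoid_scheme" and T :: "('t, 'l) monoid_scheme"
    and B :: "('f, 'b, 'p) module_scheme" and DB :: "'s \<Rightarrow> 'b set"
    and C :: "('f, 'c, 'q) module_scheme" and DC :: "'t \<Rightarrow> 'c set"
    and \<alpha> :: "'s \<Rightarrow> 't \<Rightarrow> 'f" +
  fixes m
  assumes mul_closed [simp]: "x \<in> carrier V \<Longrightarrow> y \<in> carrier V \<Longrightarrow> m x y \<in> carrier V"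
    and mul_add_left: "x \<in> carrier V \<Longrightarrow> y \<in> carrier V \<Longrightarrow> z \<in> carrier V \<Longrightarrow>
      m (x \<oplus>\<^bsub>V\<^esub> y) z = m x z \<oplus>\<^bsub>V\<^esub> m y z"
    and mul_add_right: "x \<in> carrier V \<Longrightarrow> y \<in> carrier V \<Longrightarrow> z \<in> carrier V \<Longrightarrow>
      m x (y \<oplus>\<^bsub>V\<^esub> z) = m x y \<oplus>\<^bsub>V\<^esub> m x z"
    and mul_pure: "b \<in> carrier B \<Longrightarrow> s \<in> carrier S \<Longrightarrow> b' \<in> DB s \<Longrightarrow>
      t \<in> carrier T \<Longrightarrow> c \<in> DC t \<Longrightarrow> c' \<in> carrier C \<Longrightarrow>
      m (b \<boxtimes> c) (b' \<boxtimes> c') = \<alpha> s t \<odot>\<^bsub>V\<^esub> ((b \<otimes>\<^bsub>B\<^esub> b') \<boxtimes> (c \<otimes>\<^bsub>C\<^esub> c'))"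
begin

section \<open>Consequences of the formula: uniqueness, scalars, associativity and unit\<close>

lemma mul_unique:
  assumes "twisted_tensor F S T B DB C DC \<alpha> m'" and x: "x \<in> carrier V" and y: "y \<in> carrier V"
  shows "m x y = m' x y"
proof -
  interpret m': twisted_tensor F S T B DB C DC \<alpha> m' by fact
  show ?thesis
    using x
  proof (induction rule: graded_tensor_induct)
    case (pure s t b c)
    note t = pure(2) pure(4)
    have b: "b \<in> carrier B" and bc: "b \<boxtimes> c \<in> carrier V"
      using B.component_closed[OF pure(1,3)] C.component_closed[OF t] by simp_all
    from y show ?case
    proof (induction rule: graded_tensor_induct)
      case (pure s' t' b' c')
      note s' = pure(1) pure(3) and c' = C.component_closed[OF pure(2,4)]
      show ?case
        unfolding mul_pure[OF b s' t c'] m'.mul_pure[OF b s' t c'] ..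
    next
      case (add y z)
      then show ?case
        using bc by (simp add: mul_add_right m'.mul_add_right)
    qed
  next
    case (add x x')
    then show ?case
      using y by (simp add: mul_add_left m'.mul_add_left)
  qed
qed

lemma mul_smult_left:
  assumes r: "r \<in> carrier F" and x: "x \<in> carrier V" and y: "y \<in> carrier V"
  shows "m (r \<odot>\<^bsub>V\<^esub> x) y = r \<odot>\<^bsub>V\<^esub> m x y"
  using x
proof (induction rule: graded_tensor_induct)
  case (pure s t b c)
  note t = pure(2) pure(4)
  have b: "b \<in> carrier B" and c: "c \<in> carrier C"
    using B.component_closed[OF pure(1,3)] C.component_closed[OF t] by simp_all
  from y show ?case
  proof (induction rule: graded_tensor_induct)
    case (pure s' t' b' c')
    note s' = pure(1) pure(3) and b' = B.component_closed[OF pure(1,3)] and c' = C.component_closed[OF pure(2,4)]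
    let ?v = "(b \<otimes>\<^bsub>B\<^esub> b') \<boxtimes> (c \<otimes>\<^bsub>C\<^esub> c')"
    \<comment> \<open>The scalar is absorbed into b, which may be any element of B in the
      formula.\<close>
    have "m (r \<odot>\<^bsub>V\<^esub> (b \<boxtimes> c)) (b' \<boxtimes> c') = \<alpha> s' t \<odot>\<^bsub>V\<^esub> ((r \<odot>\<^bsub>B\<^esub> b \<otimes>\<^bsub>B\<^esub> b') \<boxtimes> (c \<otimes>\<^bsub>C\<^esub> c'))"
      using r b c mul_pure[OF _ s' t c', of "r \<odot>\<^bsub>B\<^esub> b"] by (simp add: smult_pure)
    also have "\<dots> = \<alpha> s' t \<odot>\<^bsub>V\<^esub> (r \<odot>\<^bsub>V\<^esub> ?v)"
      using r b c b' c' by (simp add: smult_pure B.smult_mult_left)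
    also have "\<dots> = r \<odot>\<^bsub>V\<^esub> (\<alpha> s' t \<odot>\<^bsub>V\<^esub> ?v)"
      using r b c b' c' s' t by (intro V.smult_left_commute) simp_all
    finally show ?case
      unfolding mul_pure[OF b s' t c'] .
  next
    case (add y z)
    then show ?case
      using b c r by (simp add: mul_add_right V.smult_r_distr)
  qed
next
  case (add x x')
  then show ?case
    using y r by (simp add: mul_add_left V.smult_r_distr)
qed

lemma mul_smult_right:
  assumes r: "r \<in> carrier F" and x: "x \<in> carrier V" and y: "y \<in> carrier V"
  shows "m x (r \<odot>\<^bsub>V\<^esub> y) = r \<odot>\<^bsub>V\<^esub> m x y"
  using x
proof (induction rule: graded_tensor_induct)
  case (pure s t b c)
  note t = pure(2) pure(4)
  have b: "b \<in> carrier B" and c: "c \<in> carrier C"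
    using B.component_closed[OF pure(1,3)] C.component_closed[OF t] by simp_all
  from y show ?case
  proof (induction rule: graded_tensor_induct)
    case (pure s' t' b' c')
    note s' = pure(1) pure(3) and b' = B.component_closed[OF pure(1,3)] and c' = C.component_closed[OF pure(2,4)]
    let ?v = "(b \<otimes>\<^bsub>B\<^esub> b') \<boxtimes> (c \<otimes>\<^bsub>C\<^esub> c')"
    \<comment> \<open>Here r is absorbed into b', which stays in the component of degree s', so the
      formula applies with the same scalar \<alpha>(s', t).\<close>
    have "m (b \<boxtimes> c) (r \<odot>\<^bsub>V\<^esub> (b' \<boxtimes> c')) = \<alpha> s' t \<odot>\<^bsub>V\<^esub> ((b \<otimes>\<^bsub>B\<^esub> (r \<odot>\<^bsub>B\<^esub> b')) \<boxtimes> (c \<otimes>\<^bsub>C\<^esub> c'))"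
      using r b' c' mul_pure[OF b s'(1) B.component_smult[OF s'(1) r s'(2)] t c'] by (simp add: smult_pure)
    also have "\<dots> = \<alpha> s' t \<odot>\<^bsub>V\<^esub> (r \<odot>\<^bsub>V\<^esub> ?v)"
      using r b c b' c' by (simp add: smult_pure B.smult_mult_right)
    also have "\<dots> = r \<odot>\<^bsub>V\<^esub> (\<alpha> s' t \<odot>\<^bsub>V\<^esub> ?v)"
      using r b c b' c' s' t by (intro V.smult_left_commute) simp_all
    finally show ?case
      unfolding mul_pure[OF b s' t c'] .
  next
    case (add y z)
    then show ?case
      using b c r by (simp add: mul_add_right V.smult_r_distr)
  qed
next
  case (add x x')
  then show ?case
    using y r by (simp add: mul_add_left V.smult_r_distr)
qed

text \<open>Both bracketings are multiples of bb'b'' \<otimes> cc'c''. The left one has the scalar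
  \<alpha>(s', t) \<alpha>(s'', tt'), the right one \<alpha>(s'', t') \<alpha>(s's'', t), and
  bimultiplicativity expands both to \<alpha>(s', t) \<alpha>(s'', t) \<alpha>(s'', t'). The
  outermost factors b and c'' are never moved past anything, so they need no degree.\<close>

lemma mul_assoc_pure:
  assumes b: "b \<in> carrier B" and t: "t \<in> carrier T" "c \<in> DC t"
    and s': "s' \<in> carrier S" "b' \<in> DB s'" and t': "t' \<in> carrier T" "c' \<in> DC t'"
    and s'': "s'' \<in> carrier S" "b'' \<in> DB s''" and c'': "c'' \<in> carrier C"
  shows "m (m (b \<boxtimes> c) (b' \<boxtimes> c')) (b'' \<boxtimes> c'') = m (b \<boxtimes> c) (m (b' \<boxtimes> c') (b'' \<boxtimes> c''))"
proof -
  note cl = b C.component_closed[OF t] B.component_closed[OF s'] C.component_closed[OF t']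
    B.component_closed[OF s''] c''
  let ?v = "(b \<otimes>\<^bsub>B\<^esub> b' \<otimes>\<^bsub>B\<^esub> b'') \<boxtimes> (c \<otimes>\<^bsub>C\<^esub> c' \<otimes>\<^bsub>C\<^esub> c'')"
  have v: "?v \<in> carrier V"
    using cl by simp
  have "m (m (b \<boxtimes> c) (b' \<boxtimes> c')) (b'' \<boxtimes> c'') =
      \<alpha> s' t \<odot>\<^bsub>V\<^esub> m ((b \<otimes>\<^bsub>B\<^esub> b') \<boxtimes> (c \<otimes>\<^bsub>C\<^esub> c')) (b'' \<boxtimes> c'')"
    using cl t s' by (simp add: mul_pure[OF b s' t] mul_smult_left)
  also have "\<dots> = \<alpha> s' t \<odot>\<^bsub>V\<^esub> (\<alpha> s'' (t \<otimes>\<^bsub>T\<^esub> t') \<odot>\<^bsub>V\<^esub> ?v)"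
    using cl t t' by (subst mul_pure[OF _ s'', of _ "t \<otimes>\<^bsub>T\<^esub> t'"]) (simp_all add: C.component_mult)
  also have "\<dots> = (\<alpha> s' t \<otimes>\<^bsub>F\<^esub> (\<alpha> s'' t \<otimes>\<^bsub>F\<^esub> \<alpha> s'' t')) \<odot>\<^bsub>V\<^esub> ?v"
    using v t(1) t'(1) s'(1) s''(1) by (simp add: pairing_mult V.smult_assoc1)
  also have "\<dots> = (\<alpha> s'' t' \<otimes>\<^bsub>F\<^esub> (\<alpha> s' t \<otimes>\<^bsub>F\<^esub> \<alpha> s'' t)) \<odot>\<^bsub>V\<^esub> ?v"
    using t(1) t'(1) s'(1) s''(1) by (simp add: B.F.m_ac)
  also have "\<dots> = \<alpha> s'' t' \<odot>\<^bsub>V\<^esub> (\<alpha> (s' \<otimes>\<^bsub>S\<^esub> s'') t \<odot>\<^bsub>V\<^esub> ?v)"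
    using v t(1) t'(1) s'(1) s''(1) by (simp add: pairing_mult V.smult_assoc1)
  also have "\<dots> = \<alpha> s'' t' \<odot>\<^bsub>V\<^esub> m (b \<boxtimes> c) ((b' \<otimes>\<^bsub>B\<^esub> b'') \<boxtimes> (c' \<otimes>\<^bsub>C\<^esub> c''))"
    using cl s' s'' by (subst mul_pure[OF b _ _ t, of "s' \<otimes>\<^bsub>S\<^esub> s''"])
      (simp_all add: B.component_mult B.A.m_assoc C.A.m_assoc)
  also have "\<dots> = m (b \<boxtimes> c) (m (b' \<boxtimes> c') (b'' \<boxtimes> c''))"
    using cl t' s'' by (simp add: mul_pure[OF _ s'' t'] mul_smult_right)
  finally show ?thesis .
qed

lemma mul_assoc:
  assumes x: "x \<in> carrier V" and y: "y \<in> carrier V" and z: "z \<in> carrier V"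
  shows "m (m x y) z = m x (m y z)"
  using x
proof (induction rule: graded_tensor_induct)
  case (pure s t b c)
  note st = pure
  from st have bc: "b \<in> carrier B" "b \<boxtimes> c \<in> carrier V"
    using B.component_closed C.component_closed by auto
  from y show ?case
  proof (induction rule: graded_tensor_induct)
    case (pure s' t' b' c')
    note st' = pure
    from st' have bc': "b' \<boxtimes> c' \<in> carrier V"
      using B.component_closed C.component_closed by auto
    from z show ?case
    proof (induction rule: graded_tensor_induct)
      case (pure s'' t'' b'' c'')
      then show ?case
        using st st' bc C.component_closed by (intro mul_assoc_pure) auto
    next
      case (add z z')
      then show ?case
        using bc bc' by (simp add: mul_add_right)
    qed
  next
    case (add y y')
    then show ?case
      using bc z by (simp add: mul_add_right mul_add_left)
  qed
next
  case (add x x')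
  then show ?case
    using y z by (simp add: mul_add_left)
qed

text \<open>The unit elements of B and C are homogeneous of identity degree, so the scalars that
  occur are \<alpha>(s, 1) and \<alpha>(1, t), both equal to 1 by
  \<open>pairing_one\<close>.\<close>

lemma mul_one:
  assumes "x \<in> carrier V"
  shows "m (\<one>\<^bsub>B\<^esub> \<boxtimes> \<one>\<^bsub>C\<^esub>) x = x" "m x (\<one>\<^bsub>B\<^esub> \<boxtimes> \<one>\<^bsub>C\<^esub>) = x"
proof -
  show "m (\<one>\<^bsub>B\<^esub> \<boxtimes> \<one>\<^bsub>C\<^esub>) x = x"
    using assms
  proof (induction rule: graded_tensor_induct)
    case (pure s t b c)
    then show ?case
      using B.component_closed[of s b] C.component_closed[of t c]
      by (simp add: mul_pure[OF _ _ _ C.S.one_closed C.one_component] pairing_one)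
  qed (simp add: mul_add_right)
  show "m x (\<one>\<^bsub>B\<^esub> \<boxtimes> \<one>\<^bsub>C\<^esub>) = x"
    using assms
  proof (induction rule: graded_tensor_induct)
    case (pure s t b c)
    then show ?case
      using B.component_closed[of s b] C.component_closed[of t c]
      by (simp add: mul_pure[OF _ B.S.one_closed B.one_component] pairing_one)
  qed (simp add: mul_add_left)
qed

section \<open>The algebra structure and its grading\<close>

abbreviation A where "A \<equiv> tensor_algebra F B C m (\<one>\<^bsub>B\<^esub> \<boxtimes> \<one>\<^bsub>C\<^esub>)"

lemma ring_A: "ring A"
proof -
  interpret A: module F A
    by (rule module_tensor_algebra)
  show ?thesis
  proof (rule ringI)
    show "monoid A"
      by (rule monoidI) (simp_all add: tensor_algebra_simps mul_assoc mul_one)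
  qed (simp_all add: tensor_algebra_simps mul_add_left mul_add_right A.abelian_group_axioms)
qed

lemma mul_W:
  assumes s: "s \<in> carrier S" and s': "s' \<in> carrier S" and t: "t \<in> carrier T" and t': "t' \<in> carrier T"
    and x: "x \<in> W (s, t)" and y: "y \<in> W (s', t')"
  shows "m x y \<in> W (s \<otimes>\<^bsub>S\<^esub> s', t \<otimes>\<^bsub>T\<^esub> t')"
  using x s t
proof (induction rule: W_induct)
  case (pure b c)
  then have bc: "b \<in> carrier B" "c \<in> carrier C"
    using s t B.component_closed C.component_closed by auto
  from y s' t' show ?case
  proof (induction rule: W_induct)
    case (pure b' c')
    then have "m (b \<boxtimes> c) (b' \<boxtimes> c') = \<alpha> s' t \<odot>\<^bsub>V\<^esub> ((b \<otimes>\<^bsub>B\<^esub> b') \<boxtimes> (c \<otimes>\<^bsub>C\<^esub> c'))"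
      using bc s' t t' C.component_closed \<open>c \<in> DC t\<close> by (intro mul_pure) auto
    moreover have "(b \<otimes>\<^bsub>B\<^esub> b') \<boxtimes> (c \<otimes>\<^bsub>C\<^esub> c') \<in> W (s \<otimes>\<^bsub>S\<^esub> s', t \<otimes>\<^bsub>T\<^esub> t')"
      using pure \<open>b \<in> DB s\<close> \<open>c \<in> DC t\<close> s s' t t' by (intro W_pure B.component_mult C.component_mult)
    ultimately show ?case
      using s s' t t' by (simp add: W_smult)
  next
    case (add y z)
    then show ?case
      using bc by (simp add: mul_add_right W_add)
  qed
next
  case (add x x')
  moreover have "y \<in> carrier V"
    using W_closed[OF _ y] s' t' by simp
  ultimately show ?case
    by (simp add: mul_add_left W_add)
qed

lemma unital_algebra_A: "unital_algebra F A"
proof (intro unital_algebra.intro unital_algebra_axioms.intro)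
  show "(r \<odot>\<^bsub>A\<^esub> x) \<otimes>\<^bsub>A\<^esub> y = r \<odot>\<^bsub>A\<^esub> (x \<otimes>\<^bsub>A\<^esub> y)"
    if "r \<in> carrier F" "x \<in> carrier A" "y \<in> carrier A" for r x y
    using that by (simp add: tensor_algebra_simps mul_smult_left)
  show "x \<otimes>\<^bsub>A\<^esub> (r \<odot>\<^bsub>A\<^esub> y) = r \<odot>\<^bsub>A\<^esub> (x \<otimes>\<^bsub>A\<^esub> y)"
    if "r \<in> carrier F" "x \<in> carrier A" "y \<in> carrier A" for r x y
    using that by (simp add: tensor_algebra_simps mul_smult_right)
qed (rule B.F.field_axioms module_tensor_algebra ring_A)+

lemma graded_algebra_A: "graded_algebra F (S \<times>\<times> T) A W"
proof (intro graded_algebra.intro graded_algebra_axioms.intro)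
  show "monoid (S \<times>\<times> T)"
    by (rule DirProd_monoid[OF B.S.monoid_axioms C.S.monoid_axioms])
  show "\<exists>!f. f \<in> (\<Pi>\<^sub>E q\<in>carrier (S \<times>\<times> T). W q) \<and> finite {q \<in> carrier (S \<times>\<times> T). f q \<noteq> \<zero>\<^bsub>A\<^esub>} \<and>
           x = finsum A f {q \<in> carrier (S \<times>\<times> T). f q \<noteq> \<zero>\<^bsub>A\<^esub>}" if "x \<in> carrier A" for x
    using W_decomposition that by (simp only: tensor_algebra_simps finsum_tensor_algebra)
  show "x \<otimes>\<^bsub>A\<^esub> y \<in> W (p \<otimes>\<^bsub>S \<times>\<times> T\<^esub> q)"
    if "p \<in> carrier (S \<times>\<times> T)" "q \<in> carrier (S \<times>\<times> T)" "x \<in> W p" "y \<in> W q" for p q x y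
    using that mul_W[of "fst p" "fst q" "snd p" "snd q" x y]
    by (cases p; cases q) (simp add: tensor_algebra_simps)
  show "\<one>\<^bsub>A\<^esub> \<in> W \<one>\<^bsub>S \<times>\<times> T\<^esub>"
    using W_pure[OF B.one_component C.one_component] by (simp add: tensor_algebra_simps)
  show "submodule (W q) F A" if "q \<in> carrier (S \<times>\<times> T)" for q
    using W_submodule[OF that] by (simp only: submodule_tensor_algebra)
qed (rule unital_algebra_A)

text \<open>With 1 as the element that is passed, the scalar is \<alpha>(s, 1) = 1, so no degree
  remains and b' can be arbitrary. The case c' = 1 makes the embedding of B multiplicative, and b' =
  1 gives the factorisation of b \<otimes> c.\<close>

lemma mul_left_factor:
  assumes b: "b \<in> carrier B" and b': "b' \<in> carrier B" and c': "c' \<in> carrier C"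
  shows "m (b \<boxtimes> \<one>\<^bsub>C\<^esub>) (b' \<boxtimes> c') = (b \<otimes>\<^bsub>B\<^esub> b') \<boxtimes> c'"
  using b'
proof (induction rule: B.graded_induct)
  case (homogeneous s b')
  then show ?case
    using b c' B.component_closed[OF homogeneous]
    by (simp add: mul_pure[OF b homogeneous C.S.one_closed C.one_component c'] pairing_one)
next
  case (add b' b'')
  then show ?case
    using b c' by (simp add: pure_add_left mul_add_right B.A.r_distr)
qed

text \<open>The mirror image, with scalar \<alpha>(1, t) = 1; the case b = 1 makes the embedding of
  C multiplicative.\<close>

lemma mul_right_factor:
  assumes b: "b \<in> carrier B" and c: "c \<in> carrier C" and c': "c' \<in> carrier C"
  shows "m (b \<boxtimes> c) (\<one>\<^bsub>B\<^esub> \<boxtimes> c') = b \<boxtimes> (c \<otimes>\<^bsub>C\<^esub> c')"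
  using c
proof (induction rule: C.graded_induct)
  case (homogeneous t c)
  then show ?case
    using b c' C.component_closed[OF homogeneous]
    by (simp add: mul_pure[OF b B.S.one_closed B.one_component homogeneous c'] pairing_one)
next
  case (add c c'')
  then show ?case
    using b c' by (simp add: pure_add_right mul_add_left C.A.l_distr)
qed

lemma left_hom: "(\<lambda>b. b \<boxtimes> \<one>\<^bsub>C\<^esub>) \<in> algebra_hom F B A"
  unfolding algebra_hom_def ring_hom_def
  by (simp add: tensor_algebra_simps mul_left_factor pure_add_left smult_pure)

text \<open>Scalars act on the left factor by definition, so for this embedding
  \<open>pure_balanced\<close> has to carry them over to C.\<close>

lemma right_hom: "(\<lambda>c. \<one>\<^bsub>B\<^esub> \<boxtimes> c) \<in> algebra_hom F C A"
  unfolding algebra_hom_def ring_hom_def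
  by (simp add: tensor_algebra_simps mul_right_factor pure_add_right smult_pure pure_balanced)

end

section \<open>Injectivity of the two embeddings\<close>

context graded_tensor
begin

text \<open>The bilinear map (b, c) \<mapsto> l(c) b induces a left inverse, since it sends b
  \<otimes> 1 to l(1) b = b.\<close>

lemma left_inj:
  assumes "\<one>\<^bsub>C\<^esub> \<noteq> \<zero>\<^bsub>C\<^esub>"
  shows "inj_on (\<lambda>b. b \<boxtimes> \<one>\<^bsub>C\<^esub>) (carrier B)"
proof -
  obtain l where l: "\<And>c. c \<in> carrier C \<Longrightarrow> l c \<in> carrier F"
      "\<And>c c'. c \<in> carrier C \<Longrightarrow> c' \<in> carrier C \<Longrightarrow> l (c \<oplus>\<^bsub>C\<^esub> c') = l c \<oplus>\<^bsub>F\<^esub> l c'"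
      "\<And>r c. r \<in> carrier F \<Longrightarrow> c \<in> carrier C \<Longrightarrow> l (r \<odot>\<^bsub>C\<^esub> c) = r \<otimes>\<^bsub>F\<^esub> l c"
      "l \<one>\<^bsub>C\<^esub> = \<one>\<^bsub>F\<^esub>"
    using assms by (rule exists_functional[OF B.F.field_axioms C.module_axioms C.A.one_closed]) (rule that)
  obtain h where h: "\<And>b c. b \<in> carrier B \<Longrightarrow> c \<in> carrier C \<Longrightarrow> h (b \<boxtimes> c) = l c \<odot>\<^bsub>B\<^esub> b"
  proof (rule tensor_universal[of B "\<lambda>b c. l c \<odot>\<^bsub>B\<^esub> b"])
    show "l c \<odot>\<^bsub>B\<^esub> (r \<odot>\<^bsub>B\<^esub> b) = l (r \<odot>\<^bsub>C\<^esub> c) \<odot>\<^bsub>B\<^esub> b"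
      if "r \<in> carrier F" "b \<in> carrier B" "c \<in> carrier C" for r b c
      using that l(1) by (simp add: l(3) B.smult_assoc1 B.smult_left_commute)
    fix h assume "\<And>b c. b \<in> carrier B \<Longrightarrow> c \<in> carrier C \<Longrightarrow> h (b \<boxtimes> c) = l c \<odot>\<^bsub>B\<^esub> b"
    then show thesis
      by (rule that)
  qed (simp_all add: l B.smult_r_distr B.smult_l_distr B.M.abelian_group_axioms)
  have "h (b \<boxtimes> \<one>\<^bsub>C\<^esub>) = b" if "b \<in> carrier B" for b
    using that by (simp add: h l(4))
  then show ?thesis
    by (rule inj_on_inverseI)
qed

lemma right_inj:
  assumes "\<one>\<^bsub>B\<^esub> \<noteq> \<zero>\<^bsub>B\<^esub>"
  shows "inj_on (\<lambda>c. \<one>\<^bsub>B\<^esub> \<boxtimes> c) (carrier C)"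
proof -
  obtain l where l: "\<And>b. b \<in> carrier B \<Longrightarrow> l b \<in> carrier F"
      "\<And>b b'. b \<in> carrier B \<Longrightarrow> b' \<in> carrier B \<Longrightarrow> l (b \<oplus>\<^bsub>B\<^esub> b') = l b \<oplus>\<^bsub>F\<^esub> l b'"
      "\<And>r b. r \<in> carrier F \<Longrightarrow> b \<in> carrier B \<Longrightarrow> l (r \<odot>\<^bsub>B\<^esub> b) = r \<otimes>\<^bsub>F\<^esub> l b"
      "l \<one>\<^bsub>B\<^esub> = \<one>\<^bsub>F\<^esub>"
    using assms by (rule exists_functional[OF B.F.field_axioms B.module_axioms B.A.one_closed]) (rule that)
  obtain h where h: "\<And>b c. b \<in> carrier B \<Longrightarrow> c \<in> carrier C \<Longrightarrow> h (b \<boxtimes> c) = l b \<odot>\<^bsub>C\<^esub> c"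
  proof (rule tensor_universal[of C "\<lambda>b c. l b \<odot>\<^bsub>C\<^esub> c"])
    show "l (r \<odot>\<^bsub>B\<^esub> b) \<odot>\<^bsub>C\<^esub> c = l b \<odot>\<^bsub>C\<^esub> (r \<odot>\<^bsub>C\<^esub> c)"
      if "r \<in> carrier F" "b \<in> carrier B" "c \<in> carrier C" for r b c
      using that l(1) by (simp add: l(3) C.smult_assoc1 C.smult_left_commute)
    fix h assume "\<And>b c. b \<in> carrier B \<Longrightarrow> c \<in> carrier C \<Longrightarrow> h (b \<boxtimes> c) = l b \<odot>\<^bsub>C\<^esub> c"
    then show thesis
      by (rule that)
  qed (simp_all add: l C.smult_r_distr C.smult_l_distr C.M.abelian_group_axioms)
  have "h (\<one>\<^bsub>B\<^esub> \<boxtimes> c) = c" if "c \<in> carrier C" for c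
    using that by (simp add: h l(4))
  then show ?thesis
    by (rule inj_on_inverseI)
qed

end

lemma (in twisted_tensor) twisted_product:
  "twisted_product F S B DB T C DC \<alpha> m (\<one>\<^bsub>B\<^esub> \<boxtimes> \<one>\<^bsub>C\<^esub>)"
proof -
  have "b \<boxtimes> \<one>\<^bsub>C\<^esub> \<otimes>\<^bsub>A\<^esub> \<one>\<^bsub>B\<^esub> \<boxtimes> c = b \<boxtimes> c" if "b \<in> carrier B" "c \<in> carrier C" for b c
    using that by (simp add: tensor_algebra_simps mul_left_factor)
  \<comment> \<open>The commutation rule is the formula with 1 as both outer factors.\<close>
  moreover have "\<one>\<^bsub>B\<^esub> \<boxtimes> c \<otimes>\<^bsub>A\<^esub> b \<boxtimes> \<one>\<^bsub>C\<^esub> = \<alpha> s t \<odot>\<^bsub>A\<^esub> b \<boxtimes> c"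
    if "s \<in> carrier S" "t \<in> carrier T" "b \<in> DB s" "c \<in> DC t" for s t b c
    using mul_pure[OF B.A.one_closed that(1,3) that(2,4) C.A.one_closed]
      B.component_closed[OF that(1,3)] C.component_closed[OF that(2,4)]
    by (simp add: tensor_algebra_simps)
  ultimately show ?thesis
    unfolding twisted_product_def Let_def
    using graded_algebra_A left_hom right_hom left_inj right_inj
      algebra_hom_image[OF B.unital_algebra_axioms unital_algebra_A left_hom]
      algebra_hom_image[OF C.unital_algebra_axioms unital_algebra_A right_hom]
    by simp
qed

section \<open>Every twisted product obeys the formula, and some product does\<close>

context graded_tensor
begin

lemma twisted_product_imp_twisted_tensor:
  assumes "twisted_product F S B DB T C DC \<alpha> m u"
  shows "twisted_tensor F S T B DB C DC \<alpha> m"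
proof -
  let ?A = "tensor_algebra F B C m u"
  have A: "graded_algebra F (S \<times>\<times> T) ?A W"
    and left: "(\<lambda>b. b \<boxtimes> \<one>\<^bsub>C\<^esub>) \<in> algebra_hom F B ?A"
    and right: "(\<lambda>c. \<one>\<^bsub>B\<^esub> \<boxtimes> c) \<in> algebra_hom F C ?A"
    and factor: "\<And>b c. b \<in> carrier B \<Longrightarrow> c \<in> carrier C \<Longrightarrow> m (b \<boxtimes> \<one>\<^bsub>C\<^esub>) (\<one>\<^bsub>B\<^esub> \<boxtimes> c) = b \<boxtimes> c"
    and commute: "\<And>s t b c. s \<in> carrier S \<Longrightarrow> t \<in> carrier T \<Longrightarrow> b \<in> DB s \<Longrightarrow> c \<in> DC t \<Longrightarrow>
      m (\<one>\<^bsub>B\<^esub> \<boxtimes> c) (b \<boxtimes> \<one>\<^bsub>C\<^esub>) = \<alpha> s t \<odot>\<^bsub>V\<^esub> (b \<boxtimes> c)"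
    using assms unfolding twisted_product_def Let_def tensor_algebra_simps by simp_all
  interpret A: graded_algebra F "S \<times>\<times> T" ?A W
    by (rule A)
  have closed: "m x y \<in> carrier V" if "x \<in> carrier V" "y \<in> carrier V" for x y
    using A.A.m_closed[of x y] that by (simp only: tensor_algebra_simps)
  have assoc: "m (m x y) z = m x (m y z)" if "x \<in> carrier V" "y \<in> carrier V" "z \<in> carrier V" for x y z
    using A.A.m_assoc[of x y z] that by (simp only: tensor_algebra_simps)
  have smult_left: "m (r \<odot>\<^bsub>V\<^esub> x) y = r \<odot>\<^bsub>V\<^esub> m x y"
    if "r \<in> carrier F" "x \<in> carrier V" "y \<in> carrier V" for r x y
    using A.smult_mult_left[of r x y] that by (simp only: tensor_algebra_simps)
  have smult_right: "m x (r \<odot>\<^bsub>V\<^esub> y) = r \<odot>\<^bsub>V\<^esub> m x y"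
    if "r \<in> carrier F" "x \<in> carrier V" "y \<in> carrier V" for r x y
    using A.smult_mult_right[of r x y] that by (simp only: tensor_algebra_simps)
  have left_mult: "m (b \<boxtimes> \<one>\<^bsub>C\<^esub>) (b' \<boxtimes> \<one>\<^bsub>C\<^esub>) = (b \<otimes>\<^bsub>B\<^esub> b') \<boxtimes> \<one>\<^bsub>C\<^esub>"
    if "b \<in> carrier B" "b' \<in> carrier B" for b b'
    using left that by (simp add: algebra_hom_def ring_hom_def tensor_algebra_simps)
  have right_mult: "m (\<one>\<^bsub>B\<^esub> \<boxtimes> c) (\<one>\<^bsub>B\<^esub> \<boxtimes> c') = \<one>\<^bsub>B\<^esub> \<boxtimes> (c \<otimes>\<^bsub>C\<^esub> c')"
    if "c \<in> carrier C" "c' \<in> carrier C" for c c'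
    using right that by (simp add: algebra_hom_def ring_hom_def tensor_algebra_simps)
  show ?thesis
  proof (intro twisted_tensor.intro twisted_tensor_axioms.intro)
    show "m (x \<oplus>\<^bsub>V\<^esub> y) z = m x z \<oplus>\<^bsub>V\<^esub> m y z" if "x \<in> carrier V" "y \<in> carrier V" "z \<in> carrier V" for x y z
      using A.A.l_distr[of x y z] that by (simp only: tensor_algebra_simps)
    show "m x (y \<oplus>\<^bsub>V\<^esub> z) = m x y \<oplus>\<^bsub>V\<^esub> m x z" if "x \<in> carrier V" "y \<in> carrier V" "z \<in> carrier V" for x y z
      using A.A.r_distr[of y z x] that by (simp only: tensor_algebra_simps)
    fix b s b' t c c'
    assume b: "b \<in> carrier B" and s: "s \<in> carrier S" "b' \<in> DB s"
      and t: "t \<in> carrier T" "c \<in> DC t" and c': "c' \<in> carrier C"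
    note b' = B.component_closed[OF s] and c = C.component_closed[OF t]
    let ?\<beta> = "b \<boxtimes> \<one>\<^bsub>C\<^esub>" and ?\<beta>' = "b' \<boxtimes> \<one>\<^bsub>C\<^esub>"
      and ?\<gamma> = "\<one>\<^bsub>B\<^esub> \<boxtimes> c" and ?\<gamma>' = "\<one>\<^bsub>B\<^esub> \<boxtimes> c'"
    have cl: "?\<beta> \<in> carrier V" "?\<beta>' \<in> carrier V" "?\<gamma> \<in> carrier V" "?\<gamma>' \<in> carrier V"
      using b b' c c' by simp_all
    \<comment> \<open>Each pure tensor is split into its two embedded factors, so that reassociating
      brings c next to b', the only pair that has to be exchanged.\<close>
    have "m (b \<boxtimes> c) (b' \<boxtimes> c') = m (m ?\<beta> ?\<gamma>) (m ?\<beta>' ?\<gamma>')"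
      using b b' c c' by (simp add: factor)
    also have "\<dots> = m ?\<beta> (m (m ?\<gamma> ?\<beta>') ?\<gamma>')"
      using cl by (simp add: assoc closed)
    also have "m ?\<gamma> ?\<beta>' = \<alpha> s t \<odot>\<^bsub>V\<^esub> m ?\<beta>' ?\<gamma>"
      using b' c by (simp add: factor commute[OF s(1) t(1) s(2) t(2)])
    \<comment> \<open>The factors now stand in the order b, b', c, c': the scalar is pulled out
      through both arguments, and regrouping lets each embedding multiply its own pair.\<close>
    also have "m ?\<beta> (m (\<alpha> s t \<odot>\<^bsub>V\<^esub> m ?\<beta>' ?\<gamma>) ?\<gamma>') = \<alpha> s t \<odot>\<^bsub>V\<^esub> m (m ?\<beta> ?\<beta>') (m ?\<gamma> ?\<gamma>')"
      using cl s(1) t(1) by (simp add: smult_left smult_right assoc closed)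
    also have "m (m ?\<beta> ?\<beta>') (m ?\<gamma> ?\<gamma>') = (b \<otimes>\<^bsub>B\<^esub> b') \<boxtimes> (c \<otimes>\<^bsub>C\<^esub> c')"
      using b b' c c' by (simp add: left_mult right_mult factor)
    finally show "m (b \<boxtimes> c) (b' \<boxtimes> c') = \<alpha> s t \<odot>\<^bsub>V\<^esub> ((b \<otimes>\<^bsub>B\<^esub> b') \<boxtimes> (c \<otimes>\<^bsub>C\<^esub> c'))" .
  qed (rule graded_tensor_axioms closed; assumption?)+
qed

text \<open>\<open>tmul\<close> is cut down to V in both arguments because uniqueness is stated
  among functions that are extensional on the carrier; its values on V are unchanged.\<close>

lemma twisted_tensor_exists:
  "twisted_tensor F S T B DB C DC \<alpha> (\<lambda>x\<in>carrier V. \<lambda>y\<in>carrier V. tmul x y)"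
proof (intro twisted_tensor.intro twisted_tensor_axioms.intro)
  fix b s b' t c c'
  assume *: "b \<in> carrier B" "s \<in> carrier S" "b' \<in> DB s" "t \<in> carrier T" "c \<in> DC t" "c' \<in> carrier C"
  then have "b \<boxtimes> c \<in> carrier V" "b' \<boxtimes> c' \<in> carrier V"
    using B.component_closed[of s b'] C.component_closed[of t c] by simp_all
  then show "(\<lambda>x\<in>carrier V. \<lambda>y\<in>carrier V. tmul x y) (b \<boxtimes> c) (b' \<boxtimes> c') =
      \<alpha> s t \<odot>\<^bsub>V\<^esub> ((b \<otimes>\<^bsub>B\<^esub> b') \<boxtimes> (c \<otimes>\<^bsub>C\<^esub> c'))"
    using tmul_pure[OF *] by simp
qed (simp_all add: graded_tensor_axioms tmul_add_left add_hom_add[OF tmul_hom] add_hom_closed[OF tmul_hom])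

end

theorem lemma3p7:
  fixes F :: "('f, 'n) ring_scheme"
    and S :: "('s, 'k) monoid_scheme" and T :: "('t, 'l) monoid_scheme"
    and B :: "('f, 'b, 'p) module_scheme" and DB :: "'s \<Rightarrow> 'b set"
    and C :: "('f, 'c, 'q) module_scheme" and DC :: "'t \<Rightarrow> 'c set"
    and \<alpha> :: "'s \<Rightarrow> 't \<Rightarrow> 'f"
  assumes "field F" and "monoid S" and "monoid T"
    and "graded_algebra F S B DB"
    and "graded_algebra F T C DC"
    and "\<alpha> \<in> pairings S T F"
  shows "\<exists>!m. m \<in> tensor_carrier F B C \<rightarrow>\<^sub>E tensor_carrier F B C \<rightarrow>\<^sub>E tensor_carrier F B C \<and>
              (\<exists>u. twisted_product F S B DB T C DC \<alpha> m u)"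
proof -
  interpret graded_tensor F S T B DB C DC \<alpha>
    using assms by (intro graded_tensor.intro graded_tensor_axioms.intro)
  let ?m = "\<lambda>x\<in>carrier V. \<lambda>y\<in>carrier V. tmul x y"
  interpret m: twisted_tensor F S T B DB C DC \<alpha> ?m
    by (rule twisted_tensor_exists)
  show ?thesis
    unfolding tensor_carrier_eq
  proof (rule ex1I[of _ ?m], intro conjI)
    show "?m \<in> carrier V \<rightarrow>\<^sub>E carrier V \<rightarrow>\<^sub>E carrier V"
      using m.mul_closed by auto
    show "\<exists>u. twisted_product F S B DB T C DC \<alpha> ?m u"
      using m.twisted_product by blast
  next
    fix m'
    assume m': "m' \<in> carrier V \<rightarrow>\<^sub>E carrier V \<rightarrow>\<^sub>E carrier V \<and> (\<exists>u. twisted_product F S B DB T C DC \<alpha> m' u)"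
    \<comment> \<open>The unit that comes with m' is not fixed in advance; passing to
      \<open>twisted_tensor\<close> keeps only the product, which is what is compared.\<close>
    then have tt: "twisted_tensor F S T B DB C DC \<alpha> m'"
      using twisted_product_imp_twisted_tensor by blast
    show "m' = ?m"
    \<comment> \<open>Both products are extensional in each argument, so agreement on V gives
      equality of functions.\<close>
    proof (rule PiE_ext)
      show "m' \<in> carrier V \<rightarrow>\<^sub>E carrier V \<rightarrow>\<^sub>E carrier V"
        by (rule conjunct1[OF m'])
      show "?m \<in> carrier V \<rightarrow>\<^sub>E carrier V \<rightarrow>\<^sub>E carrier V"
        using m.mul_closed by auto
      fix x assume x: "x \<in> carrier V"
      show "m' x = ?m x"
      proof (rule PiE_ext)
        show "m' x y = ?m x y" if "y \<in> carrier V" for y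
          using m.mul_unique[OF tt x that] ..
        show "m' x \<in> carrier V \<rightarrow>\<^sub>E carrier V"
          by (rule PiE_mem[OF conjunct1[OF m'] x])
        show "?m x \<in> carrier V \<rightarrow>\<^sub>E carrier V"
          using m.mul_closed x by auto
      qed
    qed
  qed
qed

end
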